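(* Let $X$ be a real Banach space which has DES in some direction $f\in S_{X^*}$, and assume that $X$ is convex-transitive with respect to $\mathcal{G}_F$. Then $X$ is isometrically a Hilbert space.
   Context: All Banach spaces are real. $B_X$ and $S_X$ denote the closed unit ball and the unit sphere of $X$; $X^*$ is the dual space. $\mathcal{G}_X$ is the group of all linear isometries of $X$ onto itself, and $\mathcal{G}_F=\{T\in\mathcal{G}_X: \mathrm{Rank}(I-T)<\infty\}$, where $I$ is the identity map of $X$ (the subscript $F$ is only part of the notation). For $\mathcal{G}\subset\mathcal{G}_X$, $X$ is convex-transitive with respect to $\mathcal{G}$ if $\overline{\mathrm{conv}}(\{Tx: T\in\mathcal{G}\})=B_X$ for all $x\in S_X$. An ellipsoid in a finite-dimensional space $E$ is a set $\{x\in E: (x|x)\le 1\}$, where $(\cdot|\cdot)$ is an inner product on $E$. For a finite-dimensional subspace $E\subset X$, $\mathcal{E}_E\subset E$ denotes the unique minimum volume (Lebesgue measure on $E$) ellipsoid containing $B_X\cap E$. For $f\in S_{X^*}$ put $\eta(f,E)=\max\{|f(y)|: y\in\mathcal{E}_E\}$. $X$ has Directionally Euclidean Structure (DES) in direction $f\in S_{X^*}$ if $\inf_H\sup_E\eta(f,E)<\infty$, where the infimum is over finite-dimensional subspaces $H\subset X$ and the supremum is over finite-dimensional subspaces $E\subset X$ with $H\subset E$. *)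

theory Defs
  imports "HOL-Analysis.Analysis"
begin

definition finite_dim_subspace :: "'a::real_vector set \<Rightarrow> bool" where
  "finite_dim_subspace E \<longleftrightarrow> (\<exists>B. finite B \<and> E = span B)"

definition linear_isometries :: "('a::real_normed_vector \<Rightarrow> 'a) set" where
  "linear_isometries = {T. linear T \<and> surj T \<and> (\<forall>x. norm (T x) = norm x)}"

definition finite_rank_isometries :: "('a::real_normed_vector \<Rightarrow> 'a) set" where
  "finite_rank_isometries =
     {T \<in> linear_isometries. finite_dim_subspace (range (\<lambda>x. x - T x))}"

definition convex_transitive :: "('a::real_normed_vector \<Rightarrow> 'a) set \<Rightarrow> bool" where
  "convex_transitive G \<longleftrightarrow>
     (\<forall>x\<in>sphere 0 1. closure (convex hull {T x | T. T \<in> G}) = cball 0 1)"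

definition inner_product_on :: "'a::real_vector set \<Rightarrow> ('a \<Rightarrow> 'a \<Rightarrow> real) \<Rightarrow> bool" where
  "inner_product_on E p \<longleftrightarrow>
     (\<forall>x\<in>E. \<forall>y\<in>E. p x y = p y x) \<and>
     (\<forall>x\<in>E. \<forall>y\<in>E. \<forall>z\<in>E. p (x + y) z = p x z + p y z) \<and>
     (\<forall>a. \<forall>x\<in>E. \<forall>y\<in>E. p (a *\<^sub>R x) y = a * p x y) \<and>
     (\<forall>x\<in>E. x \<noteq> 0 \<longrightarrow> 0 < p x x)"

definition ellipsoid :: "'a::real_vector set \<Rightarrow> 'a set \<Rightarrow> bool" where
  "ellipsoid E S \<longleftrightarrow> (\<exists>p. inner_product_on E p \<and> S = {x \<in> E. p x x \<le> 1})"

definition linear_basis :: "'a::real_vector set \<Rightarrow> 'a set \<Rightarrow> bool" where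
  "linear_basis E B \<longleftrightarrow> independent B \<and> span B = E"

text \<open>Lebesgue measure on a finite-dimensional subspace \<open>E\<close> is the Lebesgue measure of the
  coordinates with respect to a basis of \<open>E\<close>. Another basis changes it only by a positive
  constant factor, which does not affect which sets have minimum volume, so the
  normalisation is fixed by an arbitrary choice of basis.\<close>

definition coord_volume :: "'a::real_vector set \<Rightarrow> 'a set \<Rightarrow> ennreal" where
  "coord_volume B S =
     emeasure (Pi\<^sub>M B (\<lambda>_. lborel :: real measure))
       {c \<in> extensional B. (\<Sum>b\<in>B. c b *\<^sub>R b) \<in> S}"

definition subspace_volume :: "'a::real_vector set \<Rightarrow> 'a set \<Rightarrow> ennreal" where
  "subspace_volume E S = coord_volume (SOME B. linear_basis E B) S"

definition min_volume_ellipsoid :: "'a::real_normed_vector set \<Rightarrow> 'a set" where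
  "min_volume_ellipsoid E =
     (THE S. ellipsoid E S \<and> cball 0 1 \<inter> E \<subseteq> S \<and>
        (\<forall>S'. ellipsoid E S' \<and> cball 0 1 \<inter> E \<subseteq> S' \<longrightarrow>
           subspace_volume E S \<le> subspace_volume E S'))"

text \<open>For finite-dimensional \<open>E\<close> the supremum is a maximum, since the ellipsoid is compact.\<close>

definition eta :: "('a::real_normed_vector \<Rightarrow>\<^sub>L real) \<Rightarrow> 'a set \<Rightarrow> real" where
  "eta f E = (SUP y\<in>min_volume_ellipsoid E. \<bar>blinfun_apply f y\<bar>)"

definition DES :: "('a::real_normed_vector \<Rightarrow>\<^sub>L real) \<Rightarrow> bool" where
  "DES f \<longleftrightarrow>
     (INF H\<in>{H. finite_dim_subspace H}.
        SUP E\<in>{E. finite_dim_subspace E \<and> H \<subseteq> E}. ereal (eta f E)) < \<infinity>"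

definition isometrically_hilbert :: "'a::real_normed_vector itself \<Rightarrow> bool" where
  "isometrically_hilbert _ \<longleftrightarrow>
     complete (UNIV :: 'a set) \<and>
     (\<exists>p. inner_product_on (UNIV :: 'a set) p \<and> (\<forall>x. norm x = sqrt (p x x)))"

end

theory Submission
  imports Defs
begin

text \<open>The proof transports one inner product from the finite-dimensional subspaces to the whole space.
For a finite-dimensional \<open>E\<close> let \<open>p\<^sub>E\<close> be the inner product whose unit ball is the minimum volume
ellipsoid \<open>\<E>\<^sub>E\<close>. Since \<open>\<E>\<^sub>E\<close> contains the unit ball of \<open>E\<close>, \<open>p\<^sub>E(x,x) \<le> \<parallel>x\<parallel>\<^sup>2\<close>, hence
\<open>\<bar>p\<^sub>E(x,y)\<bar> \<le> \<parallel>x\<parallel> \<parallel>y\<parallel>\<close>, and by Tychonoff's theorem the \<open>p\<^sub>E\<close> converge pointwise along some filter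
finer than the one of large \<open>E\<close> to a positive semidefinite form \<open>p\<close> on all of \<open>X\<close>
(lemma \<open>semi_inner_cluster\<close>). Two properties survive in the limit.

\<^item> If \<open>T\<close> is a surjective isometry and \<open>I - T\<close> has finite rank, then \<open>T E = E\<close> as soon as \<open>E\<close> contains
  the range of \<open>I - T\<close>. As \<open>T\<close> preserves the minimal volume and the unit ball of \<open>E\<close>, uniqueness of
  the ellipsoid makes \<open>p\<^sub>E\<close> invariant under \<open>T\<close> (lemma \<open>min_form_invariant\<close>), and so \<open>p\<close> is invariant.

\<^item> DES says that \<open>\<bar>f\<bar> \<le> C\<close> on \<open>\<E>\<^sub>E\<close> for large \<open>E\<close>, that is, \<open>f(x)\<^sup>2 \<le> C\<^sup>2 p\<^sub>E(x,x)\<close>. Therefore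
  \<open>f(x)\<^sup>2 \<le> C\<^sup>2 p(x,x)\<close>, and \<open>p\<close> is not zero.

The set \<open>{y. p(y,y) \<le> p(x,x)}\<close> is closed, convex and invariant, so by convex-transitivity
it contains the unit ball whenever \<open>\<parallel>x\<parallel> = 1\<close>. Thus \<open>p(x,x)\<close> is constant on the unit
sphere, and the norm is a multiple of the square root of \<open>p(x,x)\<close>
(lemma \<open>norm_hilbert_of_invariant_form\<close>).

Existence, uniqueness and invariance of the ellipsoid are obtained without determinants. The
volume \<open>V(p)\<close> of \<open>{p \<le> 1}\<close> is, up to a constant depending only on the dimension, the integral of
the positive part of \<open>1 - p\<close>. The integrand is convex in \<open>p\<close>, strictly so
somewhere when two forms of the same volume differ, whence uniqueness; and the integral is
lower semicontinuous under pointwise limits of \<open>p\<close>, whence existence. Fubini's theorem and translation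
invariance give \<open>V(p) V(q \<circ> T) = V(q) V(p \<circ> T)\<close>, which together with minimality replaces
the fact that an isometry has determinant \<open>\<plusminus>1\<close>.\<close>

section \<open>Positive semidefinite forms and their limits\<close>

text \<open>Inner products without definiteness: definiteness, unlike the other axioms, can be lost in
limits.\<close>

definition semi_inner_on :: "'a::real_vector set \<Rightarrow> ('a \<Rightarrow> 'a \<Rightarrow> real) \<Rightarrow> bool" where
  "semi_inner_on E p \<longleftrightarrow>
     (\<forall>x\<in>E. \<forall>y\<in>E. p x y = p y x) \<and>
     (\<forall>x\<in>E. \<forall>y\<in>E. \<forall>z\<in>E. p (x + y) z = p x z + p y z) \<and>
     (\<forall>a. \<forall>x\<in>E. \<forall>y\<in>E. p (a *\<^sub>R x) y = a * p x y) \<and>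
     (\<forall>x\<in>E. 0 \<le> p x x)"

lemma semi_inner_onD:
  assumes "semi_inner_on E p"
  shows semi_inner_sym: "\<And>x y. x \<in> E \<Longrightarrow> y \<in> E \<Longrightarrow> p x y = p y x"
    and semi_inner_add: "\<And>x y z. x \<in> E \<Longrightarrow> y \<in> E \<Longrightarrow> z \<in> E \<Longrightarrow> p (x + y) z = p x z + p y z"
    and semi_inner_scale: "\<And>a x y. x \<in> E \<Longrightarrow> y \<in> E \<Longrightarrow> p (a *\<^sub>R x) y = a * p x y"
    and semi_inner_ge0: "\<And>x. x \<in> E \<Longrightarrow> 0 \<le> p x x"
  using assms by (auto simp: semi_inner_on_def)

lemma semi_inner_add_right:
  assumes "semi_inner_on E p" "subspace E" "x \<in> E" "y \<in> E" "z \<in> E"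
  shows "p z (x + y) = p z x + p z y"
  using assms semi_inner_sym[OF assms(1)] semi_inner_add[OF assms(1)]
  by (metis subspace_add)

lemma semi_inner_scale_right:
  assumes "semi_inner_on E p" "subspace E" "x \<in> E" "y \<in> E"
  shows "p x (a *\<^sub>R y) = a * p x y"
  using assms semi_inner_sym[OF assms(1)] semi_inner_scale[OF assms(1)]
  by (metis subspace_scale)

lemma semi_inner_scale_scale:
  assumes "semi_inner_on E p" "subspace E" "x \<in> E"
  shows "p (a *\<^sub>R x) (a *\<^sub>R x) = a\<^sup>2 * p x x"
  using assms by (simp add: semi_inner_scale semi_inner_scale_right subspace_scale power2_eq_square)

lemma semi_inner_0:
  assumes "semi_inner_on E p" "subspace E" "y \<in> E"
  shows "p 0 y = 0" "p y 0 = 0"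
  using semi_inner_scale[OF assms(1), of 0 y 0] semi_inner_scale_right[OF assms(1,2), of y 0 0] assms(2,3)
  by (auto simp: subspace_0)

lemma semi_inner_expand:
  assumes p: "semi_inner_on E p" and E: "subspace E" and x: "x \<in> E" "y \<in> E"
  shows "p (x + t *\<^sub>R y) (x + t *\<^sub>R y) = p x x + 2 * t * p x y + t\<^sup>2 * p y y"
proof -
  have ty: "t *\<^sub>R y \<in> E" using E x by (simp add: subspace_scale)
  have "p (x + t *\<^sub>R y) (x + t *\<^sub>R y) = p x x + p x (t *\<^sub>R y) + (p (t *\<^sub>R y) x + p (t *\<^sub>R y) (t *\<^sub>R y))"
    using semi_inner_add[OF p x(1) ty subspace_add[OF E x(1) ty]]
      semi_inner_add_right[OF p E x(1) ty] x ty by simp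
  also have "\<dots> = p x x + 2 * t * p x y + t\<^sup>2 * p y y"
    using x ty E p semi_inner_sym[OF p x]
    by (simp add: semi_inner_scale[OF p] semi_inner_scale_right[OF p E] power2_eq_square algebra_simps)
  finally show ?thesis .
qed

lemma semi_inner_polarise:
  assumes p: "semi_inner_on E p" and E: "subspace E" and x: "x \<in> E" "y \<in> E"
  shows "4 * p x y = p (x + y) (x + y) - p (x - y) (x - y)"
  using semi_inner_expand[OF assms, of 1] semi_inner_expand[OF assms, of "-1"] by simp

text \<open>A Cauchy--Schwarz estimate against the norm: for unit vectors, polarisation bounds \<open>4 p(x,y)\<close>
by \<open>\<parallel>x \<plusminus> y\<parallel>\<^sup>2 \<le> 4\<close>; the general case follows by scaling.\<close>

lemma semi_inner_bound:
  assumes p: "semi_inner_on E p" and E: "subspace E" and x: "x \<in> E" "y \<in> E"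
    and le: "\<And>z. z \<in> E \<Longrightarrow> p z z \<le> (norm z)\<^sup>2"
  shows "\<bar>p x y\<bar> \<le> norm x * norm y"
proof (cases "x = 0 \<or> y = 0")
  case True
  then show ?thesis using semi_inner_0[OF p E] x by auto
next
  case False
  define u v where "u = (1 / norm x) *\<^sub>R x" and "v = (1 / norm y) *\<^sub>R y"
  have uv: "u \<in> E" "v \<in> E" "norm u = 1" "norm v = 1"
    using False x E by (auto simp: u_def v_def subspace_scale)
  have *: "u + v \<in> E" "u - v \<in> E" using uv E by (auto simp: subspace_add subspace_diff)
  have "norm (u + v) \<le> 2" "norm (u - v) \<le> 2"
    using norm_triangle_ineq[of u v] norm_triangle_ineq4[of u v] uv by auto
  then have "(norm (u + v))\<^sup>2 \<le> 2\<^sup>2" "(norm (u - v))\<^sup>2 \<le> 2\<^sup>2"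
    by (simp_all only: power_mono norm_ge_zero)
  then have "\<bar>p u v\<bar> \<le> 1"
    using semi_inner_polarise[OF p E uv(1,2)] le[OF *(1)] le[OF *(2)]
      semi_inner_ge0[OF p *(1)] semi_inner_ge0[OF p *(2)] by auto
  moreover have "p u v = p x y / (norm x * norm y)"
    unfolding u_def v_def using x E p
    by (simp add: semi_inner_scale semi_inner_scale_right subspace_scale)
  ultimately show ?thesis using False by (simp add: field_simps abs_divide abs_mult)
qed

text \<open>Tychonoff's theorem: the family takes its values in a product of compact intervals, so the
image filter has a cluster point \<open>l\<close>, and \<open>G\<close> is the part of \<open>F\<close> that converges to it.\<close>

lemma bounded_family_cluster:
  fixes P :: "'i \<Rightarrow> 'b \<Rightarrow> real"
  assumes F: "F \<noteq> bot" and K: "\<And>i x. \<bar>P i x\<bar> \<le> K x"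
  obtains G l where "G \<noteq> bot" "G \<le> F" "\<And>x. ((\<lambda>i. P i x) \<longlongrightarrow> l x) G"
proof -
  define U where "U = PiE UNIV (\<lambda>x. {-K x..K x})"
  have "compactin (product_topology (\<lambda>_. euclidean) UNIV) U"
    unfolding U_def by (subst compactin_PiE) auto
  then have U: "compact U" by (simp add: euclidean_product_topology)
  have PU: "P i \<in> U" for i using K[of i] by (auto simp: U_def abs_le_iff minus_le_iff)
  obtain l where l: "inf (nhds l) (filtermap P F) \<noteq> bot"
    using U[unfolded compact_filter, rule_format, of "filtermap P F"] F PU
    by (auto simp: filtermap_bot_iff eventually_filtermap)
  define G where "G = inf (filtercomap P (nhds l)) F"
  have "G \<noteq> bot"
  proof
    assume "G = bot"
    then have "eventually (\<lambda>_. False) G" by simp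
    then obtain Q R where Q: "eventually Q (filtercomap P (nhds l))" and R: "eventually R F"
      and QR: "\<And>i. Q i \<Longrightarrow> R i \<Longrightarrow> False"
      unfolding G_def eventually_inf by auto
    obtain Q' where Q': "eventually Q' (nhds l)" "\<And>i. Q' (P i) \<Longrightarrow> Q i"
      using Q unfolding eventually_filtercomap by auto
    have "eventually (\<lambda>z. \<not> Q' z) (filtermap P F)"
      unfolding eventually_filtermap using R by (rule eventually_mono) (use Q' QR in blast)
    then have "eventually (\<lambda>_. False) (inf (nhds l) (filtermap P F))"
      unfolding eventually_inf using Q'(1) by blast
    with l show False by (simp add: trivial_limit_def)
  qed
  moreover have "((\<lambda>i. P i x) \<longlongrightarrow> l x) G" for x
  proof -
    have lim: "(P \<longlongrightarrow> l) G"
      unfolding G_def filterlim_def by (metis filtermap_filtercomap filtermap_inf filtermap_mono inf.cobounded1 order_trans)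
    have opn: "open ((\<lambda>z :: 'b \<Rightarrow> real. z x) -` S)" if "open S" for S
      using that by (intro open_vimage continuous_on_product_coordinates)
    show ?thesis
      by (rule topological_tendstoI) (use topological_tendstoD[OF lim opn] in fastforce)
  qed
  ultimately show ?thesis using that[of G l] by (auto simp: G_def)
qed

text \<open>The domains \<open>E i\<close> may vary with \<open>i\<close>; each finite set of points of \<open>D\<close> is eventually in \<open>E i\<close>, and every
axiom of a semi-inner product involves finitely many points, so it passes to the limit.
The lemma is used twice: with a constant domain for a minimising sequence, and with the
subspaces growing to the whole space.\<close>

lemma semi_inner_cluster:
  fixes P :: "'i \<Rightarrow> 'a::real_normed_vector \<Rightarrow> 'a \<Rightarrow> real"
  assumes F: "F \<noteq> bot"
    and P: "\<And>i. semi_inner_on (E i) (P i)" and E: "\<And>i. subspace (E i)"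
    and le: "\<And>i x. x \<in> E i \<Longrightarrow> P i x x \<le> (norm x)\<^sup>2"
    and ev: "\<And>x. x \<in> D \<Longrightarrow> eventually (\<lambda>i. x \<in> E i) F"
    and D: "subspace D"
  obtains G p where "G \<noteq> bot" "G \<le> F" "semi_inner_on D p"
    "\<And>x y. x \<in> D \<Longrightarrow> y \<in> D \<Longrightarrow> ((\<lambda>i. P i x y) \<longlongrightarrow> p x y) G"
    "\<And>x. x \<in> D \<Longrightarrow> p x x \<le> (norm x)\<^sup>2"
proof -
  \<comment> \<open>The value 0 outside \<open>E i\<close> keeps the bound valid at every index.\<close>
  define R where "R i z = (if fst z \<in> E i \<and> snd z \<in> E i then P i (fst z) (snd z) else 0)" for i and z :: "'a \<times> 'a"
  have R: "\<bar>R i z\<bar> \<le> norm (fst z) * norm (snd z)" for i z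
    using semi_inner_bound[OF P E _ _ le] by (auto simp: R_def)
  obtain G l where G: "G \<noteq> bot" "G \<le> F" "\<And>z. ((\<lambda>i. R i z) \<longlongrightarrow> l z) G"
    using bounded_family_cluster[OF F, of R, OF R] by blast
  define p where "p x y = l (x, y)" for x y
  have ev': "eventually (\<lambda>i. x \<in> E i) G" if "x \<in> D" for x
    using ev[OF that] G(2) by (simp add: filter_leD)
  have lim: "((\<lambda>i. P i x y) \<longlongrightarrow> p x y) G" if "x \<in> D" "y \<in> D" for x y
  proof (rule Lim_transform_eventually)
    show "((\<lambda>i. R i (x, y)) \<longlongrightarrow> p x y) G" using G(3) by (simp add: p_def)
    show "eventually (\<lambda>i. R i (x, y) = P i x y) G"
      using ev'[OF that(1)] ev'[OF that(2)] by eventually_elim (auto simp: R_def)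
  qed
  have uniq: "a = b" if "(f \<longlongrightarrow> a) G" "(g \<longlongrightarrow> b) G" "eventually (\<lambda>i. f i = g i) G" for f g :: "'i \<Rightarrow> real" and a b
    using that G(1) by (metis Lim_transform_eventually tendsto_unique)
  have "semi_inner_on D p"
    unfolding semi_inner_on_def
  proof (intro conjI ballI allI)
    fix x y assume xy: "x \<in> D" "y \<in> D"
    show "p x y = p y x"
      by (rule uniq[OF lim[OF xy] lim[OF xy(2,1)]])
        (use ev'[OF xy(1)] ev'[OF xy(2)] in eventually_elim, auto intro: semi_inner_sym[OF P])
  next
    fix x y z assume xy: "x \<in> D" "y \<in> D" "z \<in> D"
    show "p (x + y) z = p x z + p y z"
      by (rule uniq[OF lim[OF subspace_add[OF D xy(1,2)] xy(3)] tendsto_add[OF lim[OF xy(1,3)] lim[OF xy(2,3)]]])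
        (use ev'[OF xy(1)] ev'[OF xy(2)] ev'[OF xy(3)] in eventually_elim, auto intro: semi_inner_add[OF P])
  next
    fix a x y assume xy: "x \<in> D" "y \<in> D"
    show "p (a *\<^sub>R x) y = a * p x y"
      by (rule uniq[OF lim[OF subspace_scale[OF D xy(1)] xy(2)] tendsto_mult[OF tendsto_const lim[OF xy]]])
        (use ev'[OF xy(1)] ev'[OF xy(2)] in eventually_elim, auto intro: semi_inner_scale[OF P])
  next
    fix x assume x: "x \<in> D"
    show "0 \<le> p x x"
      by (rule tendsto_lowerbound[OF lim[OF x x] _ G(1)])
        (use ev'[OF x] in eventually_elim, auto intro: semi_inner_ge0[OF P])
  qed
  moreover have "p x x \<le> (norm x)\<^sup>2" if x: "x \<in> D" for x
    by (rule tendsto_upperbound[OF lim[OF x x] _ G(1)])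
      (use ev'[OF x] in eventually_elim, auto intro: le)
  ultimately show ?thesis using that[of G p] G lim by auto
qed

section \<open>Coordinates with respect to a finite basis\<close>

lemma semi_inner_sum:
  assumes p: "semi_inner_on E p" and E: "subspace E" and S: "finite S" "S \<subseteq> E" and y: "y \<in> E"
  shows "p (\<Sum>b\<in>S. c b *\<^sub>R b) y = (\<Sum>b\<in>S. c b * p b y)"
  using S
proof (induction S rule: finite_induct)
  case empty
  then show ?case using semi_inner_0[OF p E y] by simp
next
  case (insert b S)
  have "c b *\<^sub>R b \<in> E" "(\<Sum>b\<in>S. c b *\<^sub>R b) \<in> E"
    using insert E by (auto intro!: subspace_scale subspace_sum)
  then show ?case
    using insert y by (simp add: semi_inner_add[OF p] semi_inner_scale[OF p])
qed

locale finite_basis =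
  fixes B :: "'a::real_normed_vector set"
  assumes finB: "finite B" and indB: "independent B"
begin

sublocale fps: finite_product_sigma_finite "\<lambda>_::'a. lborel :: real measure" B
  by standard (rule finB)

abbreviation M :: "('a \<Rightarrow> real) measure" where
  "M \<equiv> Pi\<^sub>M B (\<lambda>_. lborel :: real measure)"

definition comb :: "('a \<Rightarrow> real) \<Rightarrow> 'a" where
  "comb c = (\<Sum>b\<in>B. c b *\<^sub>R b)"

lemma space_M: "space M = extensional B"
  by (simp add: space_PiM PiE_def)

lemma comb_span [simp]: "comb c \<in> span B"
  unfolding comb_def by (intro span_sum span_scale span_base)

lemma comb_cong: "(\<And>b. b \<in> B \<Longrightarrow> c b = d b) \<Longrightarrow> comb c = comb d"
  by (simp add: comb_def)

lemma comb_eq_0: "comb c = 0 \<Longrightarrow> b \<in> B \<Longrightarrow> c b = 0"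
  using independentD[OF indB finB subset_refl] by (auto simp: comb_def)

lemma comb_0: "(\<And>b. b \<in> B \<Longrightarrow> c b = 0) \<Longrightarrow> comb c = 0"
  by (simp add: comb_def)

lemma comb_add: "comb (\<lambda>b. c b + d b) = comb c + comb d"
  by (simp add: comb_def scaleR_add_left sum.distrib)

lemma comb_diff: "comb (\<lambda>b. c b - d b) = comb c - comb d"
  by (simp add: comb_def scaleR_diff_left sum_subtractf)

lemma comb_scale: "comb (\<lambda>b. r * c b) = r *\<^sub>R comb c"
  by (simp add: comb_def scaleR_sum_right)

lemma comb_surj:
  assumes "x \<in> span B" obtains c where "comb c = x"
  using assms span_finite[OF finB] by (auto simp: comb_def)

lemma form_comb:
  assumes p: "semi_inner_on (span B) p"
  shows "p (comb c) (comb c) = (\<Sum>b\<in>B. \<Sum>b'\<in>B. c b * c b' * p b b')"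
proof -
  have "p (comb c) (comb c) = (\<Sum>b\<in>B. c b * p b (comb c))"
    using semi_inner_sum[OF p subspace_span finB span_superset comb_span] by (simp add: comb_def)
  also have "p b (comb c) = (\<Sum>b'\<in>B. c b' * p b b')" if "b \<in> B" for b
  proof -
    have "p b (comb c) = p (comb c) b"
      using that by (intro semi_inner_sym[OF p]) (auto intro: span_base)
    also have "\<dots> = (\<Sum>b'\<in>B. c b' * p b' b)"
      using semi_inner_sum[OF p subspace_span finB span_superset span_base[OF that]] by (simp add: comb_def)
    also have "\<dots> = (\<Sum>b'\<in>B. c b' * p b b')"
      using that by (intro sum.cong refl) (simp add: semi_inner_sym[OF p] span_base)
    finally show ?thesis .
  qed
  then have "(\<Sum>b\<in>B. c b * p b (comb c)) = (\<Sum>b\<in>B. c b * (\<Sum>b'\<in>B. c b' * p b b'))" by simp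
  finally show ?thesis by (simp add: sum_distrib_left mult.assoc)
qed

lemma measurable_form:
  assumes p: "semi_inner_on (span B) p" and u: "\<And>b. b \<in> B \<Longrightarrow> (\<lambda>w. u w b) \<in> borel_measurable N"
  shows "(\<lambda>w. p (comb (u w)) (comb (u w))) \<in> borel_measurable N"
  unfolding form_comb[OF p] using u by (intro borel_measurable_sum borel_measurable_times) auto

lemma measurable_coord: "b \<in> B \<Longrightarrow> (\<lambda>c. c b) \<in> borel_measurable M"
  using measurable_component_singleton[of b B "\<lambda>_. lborel :: real measure"] by simp

lemma measurable_form_M:
  assumes p: "semi_inner_on (span B) p"
  shows "(\<lambda>c. p (comb c) (comb c)) \<in> borel_measurable M"
  by (rule measurable_form[OF p measurable_coord])

lemma continuous_form:
  assumes p: "semi_inner_on (span B) p"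
  shows "continuous_on UNIV (\<lambda>c. p (comb c) (comb c))"
  unfolding form_comb[OF p] by (intro continuous_intros continuous_on_product_coordinates)

text \<open>Translation invariance and scaling of Lebesgue measure on the coordinates, combined in one
change of variables. The two measures agree on boxes.\<close>

lemma nn_integral_affine:
  assumes f: "f \<in> borel_measurable M" and r: "r > 0"
  shows "(\<integral>\<^sup>+c. f c \<partial>M) = ennreal (r ^ card B) * (\<integral>\<^sup>+c. f (\<lambda>b\<in>B. t b + r * c b) \<partial>M)"
proof -
  let ?h = "\<lambda>c. \<lambda>b\<in>B. t b + r * c b"
  have h: "?h \<in> measurable M M"
    by (intro measurable_restrict) (use measurable_coord in measurable)
  have "scale_measure (ennreal (r ^ card B)) (distr M M ?h) = M"
  proof (rule fps.PiM_eqI[OF finB])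
    fix A :: "'a \<Rightarrow> real set" assume A: "\<And>b. b \<in> B \<Longrightarrow> A b \<in> sets lborel"
    have vm: "(\<lambda>x. t b + r * x) -` A b \<in> sets lborel" if "b \<in> B" for b
      using measurable_sets[of "\<lambda>x. t b + r * x" borel borel "A b"] A[OF that] by simp
    have 1: "emeasure lborel (A b) = ennreal r * emeasure lborel ((\<lambda>x. t b + r * x) -` A b)"
      if "b \<in> B" for b
    proof -
      have "emeasure lborel (A b) = (\<integral>\<^sup>+x. indicator (A b) x \<partial>lborel)"
        using A[OF that] by simp
      also have "\<dots> = ennreal r * (\<integral>\<^sup>+x. indicator (A b) (t b + r * x) \<partial>lborel)"
        using A[OF that] r by (subst nn_integral_real_affine[of _ r "t b"]) auto
      also have "(\<integral>\<^sup>+x. indicator (A b) (t b + r * x) \<partial>lborel)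
          = (\<integral>\<^sup>+x. indicator ((\<lambda>x. t b + r * x) -` A b) x \<partial>lborel)"
        by (intro nn_integral_cong) (auto simp: indicator_def)
      finally show ?thesis using vm[OF that] by simp
    qed
    have 2: "?h -` PiE B A \<inter> space M = PiE B (\<lambda>b. (\<lambda>x. t b + r * x) -` A b)"
      by (auto simp: space_PiM PiE_def Pi_def)
    have "emeasure (scale_measure (ennreal (r ^ card B)) (distr M M ?h)) (PiE B A)
        = ennreal (r ^ card B) * (\<Prod>b\<in>B. emeasure lborel ((\<lambda>x. t b + r * x) -` A b))"
      using A h vm finB
      by (simp add: emeasure_distr 2 sets_PiM_I_finite fps.emeasure_PiM)
    also have "\<dots> = (\<Prod>b\<in>B. emeasure lborel (A b))"
      using r by (simp add: 1 prod.distrib ennreal_power)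
    finally show "emeasure (scale_measure (ennreal (r ^ card B)) (distr M M ?h)) (PiE B A)
        = (\<Prod>b\<in>B. emeasure lborel (A b))" .
  qed simp
  then have "(\<integral>\<^sup>+c. f c \<partial>M) = (\<integral>\<^sup>+c. f c \<partial>scale_measure (ennreal (r ^ card B)) (distr M M ?h))"
    by simp
  also have "\<dots> = ennreal (r ^ card B) * (\<integral>\<^sup>+c. f (?h c) \<partial>M)"
    using f h by (simp add: nn_integral_scale_measure nn_integral_distr)
  finally show ?thesis .
qed

lemma nn_integral_comb_affine:
  assumes f: "(\<lambda>c. f (comb c)) \<in> borel_measurable M" and r: "r > 0" and v: "v \<in> span B"
  shows "(\<integral>\<^sup>+c. f (comb c) \<partial>M) = ennreal (r ^ card B) * (\<integral>\<^sup>+c. f (v + r *\<^sub>R comb c) \<partial>M)"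
proof -
  obtain t where t: "comb t = v" using comb_surj[OF v] .
  have "comb (\<lambda>b\<in>B. t b + r * c b) = v + r *\<^sub>R comb c" for c
    by (simp add: t[symmetric] comb_scale[symmetric] comb_add[symmetric] cong: comb_cong)
  then show ?thesis using nn_integral_affine[OF f r, of t] by simp
qed

lemma nn_integral_comb_translate:
  assumes f: "(\<lambda>c. f (comb c)) \<in> borel_measurable M" and v: "v \<in> span B"
  shows "(\<integral>\<^sup>+c. f (v + comb c) \<partial>M) = (\<integral>\<^sup>+c. f (comb c) \<partial>M)"
  using nn_integral_comb_affine[OF f zero_less_one v] by simp

lemma emeasure_open_pos:
  assumes U: "open U" "c \<in> U" "c \<in> extensional B" and W: "W \<in> sets M" "U \<inter> extensional B \<subseteq> W"
  shows "emeasure M W > 0"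
proof -
  obtain X where X: "c \<in> PiE UNIV X" "\<And>i. open (X i)" "PiE UNIV X \<subseteq> U"
    using product_topology_open_contains_basis[of "\<lambda>_. euclidean" UNIV U c] U
    by (auto simp: euclidean_product_topology)
  have "emeasure lborel (X b) > 0" for b
  proof -
    obtain e where e: "e > 0" "ball (c b) e \<subseteq> X b"
      using X(1,2) by (meson PiE_mem UNIV_I open_contains_ball)
    have "0 < emeasure lborel {c b - e <..< c b + e}" using e(1) by simp
    also have "\<dots> \<le> emeasure lborel (X b)"
      using e(2) X(2) by (intro emeasure_mono) (auto simp: ball_def dist_real_def subset_iff abs_less_iff)
    finally show ?thesis .
  qed
  then have "0 < (\<Prod>b\<in>B. emeasure lborel (X b))"
    by (simp add: zero_less_iff_neq_zero finB)
  also have "\<dots> = emeasure M (PiE B X)"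
    using X(2) by (intro fps.emeasure_PiM[symmetric] finB) auto
  also have "\<dots> \<le> emeasure M W"
  proof (rule emeasure_mono[OF _ W(1)])
    have "PiE B X \<subseteq> PiE UNIV X"
    proof
      fix x assume x: "x \<in> PiE B X"
      have "x b \<in> X b" for b
      proof (cases "b \<in> B")
        case False
        then have "x b = c b" using x U(3) by (auto simp: PiE_def extensional_def)
        then show ?thesis using X(1) by (simp add: PiE_def Pi_def)
      qed (use x in auto)
      then show "x \<in> PiE UNIV X" by (simp add: PiE_def)
    qed
    moreover have "PiE B X \<subseteq> extensional B" by (auto simp: PiE_def)
    ultimately have "PiE B X \<subseteq> U \<inter> extensional B" using X(3) by (meson le_inf_iff order_trans)
    then show "PiE B X \<subseteq> W" using W(2) by (rule order_trans)
  qed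
  finally show ?thesis .
qed

text \<open>Compactness of the Euclidean unit sphere of the coordinates. The case of the norm is the
equivalence of norms in finite dimension.\<close>

lemma coercive:
  fixes g :: "('a \<Rightarrow> real) \<Rightarrow> real"
  assumes cont: "continuous_on UNIV g" and hom: "\<And>t c. g (\<lambda>b. t * c b) = t\<^sup>2 * g c"
    and cong: "\<And>c d. (\<And>b. b \<in> B \<Longrightarrow> c b = d b) \<Longrightarrow> g c = g d"
    and ge0: "\<And>c. 0 \<le> g c" and pos: "\<And>c b. g c = 0 \<Longrightarrow> b \<in> B \<Longrightarrow> c b = 0"
  obtains \<delta> where "\<delta> > 0" "\<And>c. \<delta> * (\<Sum>b\<in>B. (c b)\<^sup>2) \<le> g c"
proof -
  define U where "U = PiE UNIV (\<lambda>b. if b \<in> B then {-1..1} else {0::real})"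
  have "compactin (product_topology (\<lambda>_. euclidean) UNIV) U"
    unfolding U_def by (subst compactin_PiE) auto
  then have U: "compact U" by (simp add: euclidean_product_topology)
  define K where "K = U \<inter> ((\<lambda>c. \<Sum>b\<in>B. (c b)\<^sup>2) -` {1})"
  have "closed ((\<lambda>c :: 'a \<Rightarrow> real. \<Sum>b\<in>B. (c b)\<^sup>2) -` {1})"
    by (intro closed_vimage continuous_intros continuous_on_product_coordinates)
  then have K: "compact K" unfolding K_def using U by (rule compact_Int_closed[rotated])
  obtain \<delta> where \<delta>: "\<delta> > 0" "\<And>c. c \<in> K \<Longrightarrow> \<delta> \<le> g c"
  proof (cases "K = {}")
    case True
    then show ?thesis using that[of 1] by auto
  next
    case False
    obtain k where k: "k \<in> K" "\<And>c. c \<in> K \<Longrightarrow> g k \<le> g c"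
      using continuous_attains_inf[OF K False continuous_on_subset[OF cont]] by auto
    have "g k \<noteq> 0"
    proof
      assume "g k = 0"
      then have "(\<Sum>b\<in>B. (k b)\<^sup>2) = 0" by (intro sum.neutral ballI) (simp add: pos)
      then show False using k(1) by (simp add: K_def)
    qed
    then show ?thesis using that[of "g k"] k ge0[of k] by auto
  qed
  show ?thesis
  proof (rule that[OF \<delta>(1)])
    fix c :: "'a \<Rightarrow> real"
    define s where "s = (\<Sum>b\<in>B. (c b)\<^sup>2)"
    have s0: "0 \<le> s" by (simp add: s_def sum_nonneg)
    show "\<delta> * (\<Sum>b\<in>B. (c b)\<^sup>2) \<le> g c"
    proof (cases "s = 0")
      case True
      then show ?thesis using ge0[of c] by (simp add: s_def)
    next
      case False
      define d where "d = (\<lambda>b. if b \<in> B then c b / sqrt s else 0)"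
      have sum1: "(\<Sum>b\<in>B. (d b)\<^sup>2) = 1"
        using False s0 by (simp add: d_def power_divide sum_divide_distrib[symmetric] s_def)
      have d1: "-1 \<le> d b \<and> d b \<le> 1" if "b \<in> B" for b
      proof -
        have "(d b)\<^sup>2 \<le> (\<Sum>b\<in>B. (d b)\<^sup>2)"
          by (rule member_le_sum[OF that _ finB]) auto
        then show ?thesis using sum1 by (simp add: abs_square_le_1 abs_le_iff)
      qed
      moreover have "d b = 0" if "b \<notin> B" for b using that by (simp add: d_def)
      ultimately have "d \<in> K" using sum1 by (simp add: K_def U_def PiE_def Pi_def)
      then have "\<delta> \<le> g d" by (rule \<delta>(2))
      moreover have "g c = s * g d"
      proof -
        have "g c = g (\<lambda>b. sqrt s * d b)" using False by (intro cong) (simp add: d_def)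
        then show ?thesis using s0 by (simp add: hom)
      qed
      ultimately show ?thesis using s0 mult_left_mono[of \<delta> "g d" s]
        by (simp add: s_def[symmetric] mult.commute)
    qed
  qed
qed

lemma norm_coercive:
  obtains \<delta> where "\<delta> > 0" "\<And>c. \<delta> * (\<Sum>b\<in>B. (c b)\<^sup>2) \<le> (norm (comb c))\<^sup>2"
proof (rule coercive[of "\<lambda>c. (norm (comb c))\<^sup>2"])
  show "continuous_on UNIV (\<lambda>c. (norm (comb c))\<^sup>2)"
    unfolding comb_def by (intro continuous_intros continuous_on_product_coordinates)
  show "(norm (comb c))\<^sup>2 = (norm (comb d))\<^sup>2" if "\<And>b. b \<in> B \<Longrightarrow> c b = d b" for c d
    using comb_cong[OF that] by simp
qed (simp_all add: comb_scale power_mult_distrib comb_eq_0 that)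

lemma form_coercive:
  assumes p: "semi_inner_on (span B) p" and pd: "\<And>x. x \<in> span B \<Longrightarrow> p x x = 0 \<Longrightarrow> x = 0"
  obtains \<delta> where "\<delta> > 0" "\<And>c. \<delta> * (\<Sum>b\<in>B. (c b)\<^sup>2) \<le> p (comb c) (comb c)"
proof (rule coercive[of "\<lambda>c. p (comb c) (comb c)"])
  show "continuous_on UNIV (\<lambda>c. p (comb c) (comb c))" by (rule continuous_form[OF p])
  show "p (comb (\<lambda>b. t * c b)) (comb (\<lambda>b. t * c b)) = t\<^sup>2 * p (comb c) (comb c)" for t c
    by (simp add: comb_scale semi_inner_scale_scale[OF p])
  show "p (comb c) (comb c) = p (comb d) (comb d)" if "\<And>b. b \<in> B \<Longrightarrow> c b = d b" for c d
    using comb_cong[OF that] by simp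
  show "0 \<le> p (comb c) (comb c)" for c by (simp add: semi_inner_ge0[OF p])
  show "c b = 0" if "p (comb c) (comb c) = 0" "b \<in> B" for c b
    using pd[OF comb_span that(1)] that(2) by (rule comb_eq_0)
qed (rule that)

section \<open>Volume of ellipsoids as an integral\<close>

definition vol :: "('a \<Rightarrow> 'a \<Rightarrow> real) \<Rightarrow> ennreal" where
  "vol p = emeasure M {c \<in> space M. p (comb c) (comb c) \<le> 1}"

lemma coord_volume_eq_vol: "coord_volume B {x \<in> span B. p x x \<le> 1} = vol p"
  using comb_span by (simp add: coord_volume_def vol_def space_M comb_def)

lemma sets_sublevel:
  assumes p: "semi_inner_on (span B) p"
  shows "{c \<in> space M. p (comb c) (comb c) \<le> s} \<in> sets M"
  using measurable_form_M[OF p] by measurable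

lemma vol_eq_nn_integral:
  assumes p: "semi_inner_on (span B) p"
  shows "vol p = (\<integral>\<^sup>+c. indicator {x. p x x \<le> 1} (comb c) \<partial>M)"
proof -
  have "vol p = (\<integral>\<^sup>+c. indicator {c \<in> space M. p (comb c) (comb c) \<le> 1} c \<partial>M)"
    unfolding vol_def using sets_sublevel[OF p] by simp
  also have "\<dots> = (\<integral>\<^sup>+c. indicator {x. p x x \<le> 1} (comb c) \<partial>M)"
    by (intro nn_integral_cong) (auto simp: indicator_def)
  finally show ?thesis .
qed

lemma measurable_indicator_comb:
  assumes p: "semi_inner_on (span B) p" and u: "\<And>b. b \<in> B \<Longrightarrow> (\<lambda>w. u w b) \<in> borel_measurable N"
  shows "(\<lambda>w. indicator {x. p x x \<le> s} (comb (u w)) :: ennreal) \<in> borel_measurable N"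
  unfolding indicator_def mem_Collect_eq using measurable_form[OF p u] by measurable

lemma measurable_indicator_form:
  assumes p: "semi_inner_on (span B) p"
  shows "(\<lambda>c. indicator {x. p x x \<le> s} (comb c) :: ennreal) \<in> borel_measurable M"
  by (rule measurable_indicator_comb[OF p measurable_coord])

lemma nn_integral_sublevel:
  assumes p: "semi_inner_on (span B) p" and s: "s > 0"
  shows "(\<integral>\<^sup>+c. indicator {x. p x x \<le> s} (comb c) \<partial>M) = ennreal (sqrt s ^ card B) * vol p"
proof -
  have "(\<integral>\<^sup>+c. indicator {x. p x x \<le> s} (comb c) \<partial>M)
      = ennreal (sqrt s ^ card B) * (\<integral>\<^sup>+c. indicator {x. p x x \<le> s} (0 + sqrt s *\<^sub>R comb c) \<partial>M)"
    using s by (intro nn_integral_comb_affine measurable_indicator_form[OF p]) (auto simp: span_zero)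
  also have "(\<integral>\<^sup>+c. indicator {x. p x x \<le> s} (0 + sqrt s *\<^sub>R comb c) \<partial>M)
      = (\<integral>\<^sup>+c. indicator {x. p x x \<le> 1} (comb c) \<partial>M)"
    using s by (intro nn_integral_cong) (auto simp: indicator_def semi_inner_scale_scale[OF p])
  finally show ?thesis by (simp add: vol_eq_nn_integral[OF p])
qed

text \<open>The function \<open>ennreal\<close> sends negative numbers to 0, so the integrand is the positive part
of \<open>1 - p\<close>.\<close>

definition bump :: "('a \<Rightarrow> 'a \<Rightarrow> real) \<Rightarrow> ennreal" where
  "bump p = (\<integral>\<^sup>+c. ennreal (1 - p (comb c) (comb c)) \<partial>M)"

definition bump_const :: ennreal where
  "bump_const = (\<integral>\<^sup>+s. indicator {0<..1} s * ennreal (sqrt s ^ card B) \<partial>lborel)"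

lemma bump_const_pos: "bump_const > 0"
proof -
  have "0 < ennreal ((1/2) ^ card B) * emeasure lborel {1/4..1::real}"
    by (simp add: ennreal_zero_less_mult_iff)
  also have "\<dots> = (\<integral>\<^sup>+s. ennreal ((1/2) ^ card B) * indicator {1/4..1::real} s \<partial>lborel)"
    by (subst nn_integral_cmult_indicator) auto
  also have "\<dots> \<le> bump_const"
    unfolding bump_const_def
  proof (intro nn_integral_mono)
    fix s :: real
    have "1/2 \<le> sqrt s" if "1/4 \<le> s" using that by (intro real_le_rsqrt) (simp add: power2_eq_square)
    then show "ennreal ((1/2) ^ card B) * indicator {1/4..1} s \<le> indicator {0<..1} s * ennreal (sqrt s ^ card B)"
      by (auto simp: indicator_def intro!: ennreal_leI power_mono)
  qed
  finally show ?thesis .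
qed

lemma bump_const_finite: "bump_const < \<infinity>"
proof -
  have "bump_const \<le> (\<integral>\<^sup>+s. indicator {0<..1::real} s \<partial>lborel)"
    unfolding bump_const_def
    by (intro nn_integral_mono) (auto simp: indicator_def intro!: power_le_one)
  also have "\<dots> < \<infinity>" by simp
  finally show ?thesis .
qed

text \<open>The layer-cake formula: the positive part of \<open>1 - p\<close> is the length of \<open>{s. p \<le> s \<le> 1}\<close>, and
the volume of \<open>{p \<le> s}\<close> is \<open>s\<^bsup>n/2\<^esup>\<close> times that of \<open>{p \<le> 1}\<close>. The level \<open>s = 0\<close>, where the scaling is not
available, is a null set.\<close>

lemma bump_eq:
  assumes p: "semi_inner_on (span B) p"
  shows "bump p = bump_const * vol p"
proof -
  interpret pair_sigma_finite M "lborel :: real measure"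
    by (intro pair_sigma_finite.intro fps.sigma_finite_measure_axioms sigma_finite_lborel)
  let ?q = "\<lambda>c. p (comb c) (comb c)"
  have q[measurable]: "?q \<in> borel_measurable M" by (rule measurable_form_M[OF p])
  have q0: "0 \<le> ?q c" for c by (simp add: semi_inner_ge0[OF p])
  have "bump p = (\<integral>\<^sup>+c. (\<integral>\<^sup>+s. indicator {?q c..1} s \<partial>lborel) \<partial>M)"
    unfolding bump_def
  proof (intro nn_integral_cong)
    fix c
    show "ennreal (1 - ?q c) = (\<integral>\<^sup>+s. indicator {?q c..1} s \<partial>lborel)"
      by (cases "?q c \<le> 1") (auto simp: ennreal_neg)
  qed
  also have "\<dots> = (\<integral>\<^sup>+c. (\<integral>\<^sup>+s. (if ?q c \<le> s \<and> s \<le> 1 then 1 else 0) \<partial>lborel) \<partial>M)"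
    by (intro nn_integral_cong) (auto simp: indicator_def)
  also have "\<dots> = (\<integral>\<^sup>+s. (\<integral>\<^sup>+c. (if ?q c \<le> s \<and> s \<le> 1 then 1 else 0) \<partial>M) \<partial>lborel)"
    by (rule Fubini'[symmetric]) measurable
  also have "\<dots> = (\<integral>\<^sup>+s. indicator {0<..1} s * ennreal (sqrt s ^ card B) * vol p \<partial>lborel)"
  proof (intro nn_integral_cong_AE, rule AE_mp[OF AE_lborel_singleton[of 0]], intro AE_I2 impI)
    fix s :: real assume "s \<noteq> 0"
    then consider "s < 0" | "s > 1" | "0 < s" "s \<le> 1" by linarith
    then show "(\<integral>\<^sup>+c. (if ?q c \<le> s \<and> s \<le> 1 then 1 else 0) \<partial>M)
        = indicator {0<..1} s * ennreal (sqrt s ^ card B) * vol p"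
    proof cases
      case 1
      then have "\<not> ?q c \<le> s" for c using q0[of c] by linarith
      then show ?thesis using 1 by simp
    next
      case 3
      then have "(\<integral>\<^sup>+c. (if ?q c \<le> s \<and> s \<le> 1 then 1 else 0) \<partial>M)
          = (\<integral>\<^sup>+c. indicator {x. p x x \<le> s} (comb c) \<partial>M)"
        by (intro nn_integral_cong) (auto simp: indicator_def)
      then show ?thesis using 3 nn_integral_sublevel[OF p, of s] by simp
    qed simp
  qed
  also have "\<dots> = bump_const * vol p"
    unfolding bump_const_def by (intro nn_integral_multc) measurable
  finally show ?thesis .
qed

lemma vol_pos:
  assumes p: "semi_inner_on (span B) p"
  shows "vol p > 0"
  unfolding vol_def
proof (rule emeasure_open_pos)
  let ?U = "(\<lambda>c. p (comb c) (comb c)) -` {..<1}"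
  show "open ?U" by (intro open_vimage open_lessThan continuous_form[OF p])
  show "restrict (\<lambda>_. 0) B \<in> ?U"
    using semi_inner_0[OF p subspace_span span_zero] comb_0[of "restrict (\<lambda>_. 0) B"] by simp
  show "?U \<inter> extensional B \<subseteq> {c \<in> space M. p (comb c) (comb c) \<le> 1}" by (auto simp: space_M)
qed (simp_all add: sets_sublevel[OF p])

text \<open>As \<open>p(u,u) = 0\<close>, otherwise \<open>p(x + t u, x + t u)\<close> would be a non-constant affine
function of \<open>t\<close>, hence negative somewhere.\<close>

lemma semi_inner_null:
  assumes p: "semi_inner_on E p" and E: "subspace E" and x: "x \<in> E" "u \<in> E" and u: "p u u = 0"
  shows "p x u = 0"
proof (rule ccontr)
  assume n: "p x u \<noteq> 0"
  define t where "t = - (p x x + 1) / (2 * p x u)"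
  have "0 \<le> p (x + t *\<^sub>R u) (x + t *\<^sub>R u)"
    using x E by (intro semi_inner_ge0[OF p]) (auto simp: subspace_add subspace_scale)
  also have "\<dots> = p x x + 2 * t * p x u" using semi_inner_expand[OF p E x] u by simp
  also have "\<dots> = -1" using n by (simp add: t_def field_simps)
  finally show False by simp
qed

text \<open>If \<open>p\<close> vanishes on a line, \<open>{p \<le> 1}\<close> is a cylinder along that line. It contains infinitely
many disjoint translates \<open>W k\<close> of a slice \<open>W 0\<close> of positive measure.\<close>

lemma vol_degenerate:
  assumes p: "semi_inner_on (span B) p" and u: "u \<in> span B" "u \<noteq> 0" "p u u = 0"
  shows "vol p = \<infinity>"
proof -
  obtain d where d: "comb d = u" using comb_surj[OF u(1)] .
  obtain b where b: "b \<in> B" "d b \<noteq> 0" using comb_0[of d] u(2) d by auto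
  define W where "W k = {c \<in> space M. p (comb c) (comb c) \<le> 1 \<and> \<bar>c b - real k * d b\<bar> < \<bar>d b\<bar> / 2}" for k
  have Wsets: "W k \<in> sets M" for k
    unfolding W_def using measurable_form_M[OF p] measurable_coord[OF b(1)] by measurable
  have pt: "p (comb c + t *\<^sub>R u) (comb c + t *\<^sub>R u) = p (comb c) (comb c)" for c t
    using semi_inner_expand[OF p subspace_span comb_span u(1)]
      semi_inner_null[OF p subspace_span comb_span u(1,3)] u(3) by simp
  have shift: "emeasure M (W k) = emeasure M (W 0)" for k
  proof -
    let ?h = "\<lambda>c. \<lambda>b\<in>B. real k * d b + 1 * c b"
    have h: "comb (?h c) = comb c + real k *\<^sub>R u" for c
    proof -
      have "comb (?h c) = comb (\<lambda>b. c b + real k * d b)" by (intro comb_cong) simp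
      then show ?thesis by (simp add: comb_add comb_scale d)
    qed
    have hW: "?h c \<in> W k \<longleftrightarrow> c \<in> W 0" if "c \<in> space M" for c
      using that b unfolding W_def mem_Collect_eq h pt by (simp add: space_M)
    have "emeasure M (W k) = (\<integral>\<^sup>+c. indicator (W k) c \<partial>M)" using Wsets by simp
    also have "\<dots> = (\<integral>\<^sup>+c. indicator (W k) (?h c) \<partial>M)"
      using Wsets by (subst nn_integral_affine[of _ 1 "\<lambda>b. real k * d b"]) auto
    also have "\<dots> = (\<integral>\<^sup>+c. indicator (W 0) c \<partial>M)"
      by (intro nn_integral_cong) (use hW in \<open>simp add: indicator_def\<close>)
    finally show ?thesis using Wsets by simp
  qed
  have pos: "emeasure M (W 0) > 0"
  proof (rule emeasure_open_pos)
    let ?U = "(\<lambda>c. p (comb c) (comb c)) -` {..<1} \<inter> (\<lambda>c. c b) -` {-(\<bar>d b\<bar>/2)<..<\<bar>d b\<bar>/2}"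
    show "open ?U"
      by (intro open_Int open_vimage open_lessThan open_greaterThanLessThan continuous_form[OF p]
          continuous_on_product_coordinates)
    show "restrict (\<lambda>_. 0) B \<in> ?U"
      using semi_inner_0[OF p subspace_span span_zero] comb_0[of "restrict (\<lambda>_. 0) B"] b by simp
    show "?U \<inter> extensional B \<subseteq> W 0" by (auto simp: W_def space_M)
  qed (use Wsets in auto)
  have disj: "disjoint_family W"
    unfolding disjoint_family_on_def
  proof (intro ballI impI equals0I)
    fix i j c assume ij: "i \<noteq> j" and c: "c \<in> W i \<inter> W j"
    have "\<bar>c b - real i * d b\<bar> < \<bar>d b\<bar> / 2" "\<bar>c b - real j * d b\<bar> < \<bar>d b\<bar> / 2"
      using c by (auto simp: W_def)
    then have "\<bar>(real i - real j) * d b\<bar> < \<bar>d b\<bar>" unfolding left_diff_distrib by linarith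
    then have "\<bar>real i - real j\<bar> * \<bar>d b\<bar> < 1 * \<bar>d b\<bar>" by (simp add: abs_mult)
    then have "\<bar>real i - real j\<bar> < 1" by (rule mult_right_less_imp_less) simp
    then have "i = j" by linarith
    with ij show False by simp
  qed
  have le: "of_nat n * emeasure M (W 0) \<le> vol p" for n
  proof -
    have "of_nat n * emeasure M (W 0) = (\<Sum>k<n. emeasure M (W k))"
      by (subst sum.cong[OF refl shift]) simp
    also have "\<dots> = emeasure M (\<Union>k<n. W k)"
      using Wsets by (intro sum_emeasure disjoint_family_on_mono[OF _ disj]) auto
    also have "\<dots> \<le> vol p" unfolding vol_def
      using sets_sublevel[OF p] by (intro emeasure_mono) (auto simp: W_def)
    finally show ?thesis .
  qed
  have "\<infinity> = (SUP n. of_nat n :: ennreal) * emeasure M (W 0)"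
    using pos by (simp add: ennreal_SUP_of_nat_eq_top ennreal_top_mult)
  also have "\<dots> = (SUP n. of_nat n * emeasure M (W 0))" by (simp add: SUP_mult_right_ennreal)
  also have "\<dots> \<le> vol p" by (intro SUP_least le)
  finally show ?thesis by (simp add: top_unique)
qed

end

section \<open>Uniqueness of the minimum volume ellipsoid\<close>

lemma inner_product_pos: "inner_product_on E p \<Longrightarrow> x \<in> E \<Longrightarrow> x \<noteq> 0 \<Longrightarrow> 0 < p x x"
  by (simp add: inner_product_on_def)

lemma inner_imp_semi_inner:
  assumes p: "inner_product_on E p"
  shows "semi_inner_on E p"
proof -
  have "0 \<le> p x x" if "x \<in> E" for x
  proof (cases "x = 0")
    case True
    have "p (0 *\<^sub>R x) x = 0 * p x x" using p that unfolding inner_product_on_def by blast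
    then show ?thesis using True by simp
  next
    case False
    then show ?thesis using inner_product_pos[OF p that] by simp
  qed
  then show ?thesis using p by (simp add: inner_product_on_def semi_inner_on_def)
qed

lemma semi_inner_imp_inner:
  assumes "semi_inner_on E p" "\<And>x. x \<in> E \<Longrightarrow> p x x = 0 \<Longrightarrow> x = 0"
  shows "inner_product_on E p"
  using assms unfolding inner_product_on_def semi_inner_on_def
  by (auto simp: less_le)

text \<open>The forms whose unit ball contains the unit ball of the norm on \<open>E\<close>.\<close>

definition dominated :: "'a::real_normed_vector set \<Rightarrow> ('a \<Rightarrow> 'a \<Rightarrow> real) \<Rightarrow> bool" where
  "dominated E p \<longleftrightarrow> (\<forall>x\<in>E. p x x \<le> (norm x)\<^sup>2)"

lemma dominated_iff_ball_subset:
  assumes p: "semi_inner_on E p" and E: "subspace E"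
  shows "dominated E p \<longleftrightarrow> cball 0 1 \<inter> E \<subseteq> {x \<in> E. p x x \<le> 1}"
proof
  assume d: "dominated E p"
  show "cball 0 1 \<inter> E \<subseteq> {x \<in> E. p x x \<le> 1}"
  proof
    fix x assume "x \<in> cball 0 1 \<inter> E"
    then have x: "x \<in> E" "norm x \<le> 1" by auto
    have "p x x \<le> (norm x)\<^sup>2" using d x by (simp add: dominated_def)
    also have "\<dots> \<le> 1" using x by (simp add: power_le_one)
    finally show "x \<in> {x \<in> E. p x x \<le> 1}" using x by simp
  qed
next
  assume s: "cball 0 1 \<inter> E \<subseteq> {x \<in> E. p x x \<le> 1}"
  show "dominated E p"
    unfolding dominated_def
  proof
    fix x assume x: "x \<in> E"
    show "p x x \<le> (norm x)\<^sup>2"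
    proof (cases "x = 0")
      case True
      then show ?thesis using semi_inner_0[OF p E x] by simp
    next
      case False
      have "(1 / norm x) *\<^sub>R x \<in> cball 0 1 \<inter> E" using False x E by (simp add: subspace_scale)
      then have "p ((1 / norm x) *\<^sub>R x) ((1 / norm x) *\<^sub>R x) \<le> 1" using s by blast
      then show ?thesis using False by (simp add: semi_inner_scale_scale[OF p E x] power_divide field_simps)
    qed
  qed
qed

context finite_basis
begin

lemma sublevel_coords_bounded:
  assumes p: "inner_product_on (span B) p"
  obtains r where "r > 0" "\<And>c b. p (comb c) (comb c) \<le> 1 \<Longrightarrow> b \<in> B \<Longrightarrow> \<bar>c b\<bar> \<le> r"
proof -
  obtain \<delta> where \<delta>: "\<delta> > 0" "\<And>c. \<delta> * (\<Sum>b\<in>B. (c b)\<^sup>2) \<le> p (comb c) (comb c)"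
    using form_coercive[OF inner_imp_semi_inner[OF p]] inner_product_pos[OF p] by (metis less_irrefl)
  show ?thesis
  proof (rule that[of "sqrt (1 / \<delta>)"])
    fix c b assume c: "p (comb c) (comb c) \<le> 1" and b: "b \<in> B"
    have "(c b)\<^sup>2 \<le> (\<Sum>b\<in>B. (c b)\<^sup>2)" by (rule member_le_sum[OF b _ finB]) auto
    then have "\<delta> * (c b)\<^sup>2 \<le> \<delta> * (\<Sum>b\<in>B. (c b)\<^sup>2)" using \<delta>(1) by simp
    also have "\<dots> \<le> 1" using \<delta>(2)[of c] c by simp
    finally have "(c b)\<^sup>2 \<le> 1 / \<delta>" using \<delta>(1) by (simp add: field_simps)
    then show "\<bar>c b\<bar> \<le> sqrt (1 / \<delta>)" by (intro real_le_rsqrt) simp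
  qed (use \<delta>(1) in simp)
qed

lemma vol_finite:
  assumes p: "inner_product_on (span B) p"
  shows "vol p < \<infinity>"
proof -
  obtain r where r: "r > 0" "\<And>c b. p (comb c) (comb c) \<le> 1 \<Longrightarrow> b \<in> B \<Longrightarrow> \<bar>c b\<bar> \<le> r"
    using sublevel_coords_bounded[OF p] by blast
  have sub: "{c \<in> space M. p (comb c) (comb c) \<le> 1} \<subseteq> PiE B (\<lambda>_. {-r..r})"
    using r(2) by (auto simp: space_M PiE_def abs_le_iff minus_le_iff)
  have "vol p \<le> emeasure M (PiE B (\<lambda>_. {-r..r}))"
    unfolding vol_def by (rule emeasure_mono[OF sub]) (auto intro: sets_PiM_I_finite[OF finB])
  also have "\<dots> = (\<Prod>b\<in>B. emeasure lborel {-r..r})"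
    by (rule fps.emeasure_PiM[OF finB]) auto
  also have "\<dots> < \<infinity>" using r(1) by (simp add: power_less_top_ennreal)
  finally show ?thesis .
qed

definition min_form :: "('a \<Rightarrow> 'a \<Rightarrow> real) \<Rightarrow> bool" where
  "min_form p \<longleftrightarrow> inner_product_on (span B) p \<and> dominated (span B) p \<and>
     (\<forall>q. inner_product_on (span B) q \<and> dominated (span B) q \<longrightarrow> vol p \<le> vol q)"

lemma dominated_inner_exists: "\<exists>p. inner_product_on (span B) p \<and> dominated (span B) p"
proof -
  obtain \<delta> where \<delta>: "\<delta> > 0" "\<And>c. \<delta> * (\<Sum>b\<in>B. (c b)\<^sup>2) \<le> (norm (comb c))\<^sup>2"
    using norm_coercive by blast
  define p where "p x y = \<delta> * (\<Sum>b\<in>B. representation B x b * representation B y b)" for x y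
  have rep: "comb (representation B x) = x" if "x \<in> span B" for x
    using real_vector.sum_representation_eq[OF indB that finB subset_refl] by (simp add: comb_def)
  have "inner_product_on (span B) p"
  proof (rule semi_inner_imp_inner)
    show "semi_inner_on (span B) p"
      unfolding semi_inner_on_def
    proof (intro conjI ballI allI)
      show "0 \<le> p x x" for x
        unfolding p_def using \<delta>(1) by (simp add: sum_nonneg)
    qed (use indB in \<open>auto simp: p_def representation_add representation_scale mult.commute
          sum.distrib sum_distrib_left algebra_simps\<close>)
    fix x assume x: "x \<in> span B" "p x x = 0"
    have "(\<Sum>b\<in>B. representation B x b * representation B x b) = 0" using x(2) \<delta>(1) by (simp add: p_def)
    then have "comb (representation B x) = 0"
      by (intro comb_0) (simp add: sum_nonneg_eq_0_iff finB)
    then show "x = 0" using rep[OF x(1)] by simp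
  qed
  moreover have "dominated (span B) p"
    unfolding dominated_def
  proof
    fix x assume "x \<in> span B"
    then show "p x x \<le> (norm x)\<^sup>2"
      using \<delta>(2)[of "representation B x"] rep[of x] by (simp add: p_def power2_eq_square)
  qed
  ultimately show ?thesis by blast
qed

text \<open>If \<open>p(x,x) < q(x,x)\<close>, some multiple \<open>y\<close> of \<open>x\<close> satisfies \<open>p(y,y) < 1 < q(y,y)\<close>, and the same
holds near \<open>y\<close>. There the positive part of \<open>1 - (p + q)/2\<close> is strictly less than the mean of
the positive parts of \<open>1 - p\<close> and \<open>1 - q\<close>, while it is never larger. After integration
the mean of the two forms, which is again dominated by the norm, has a smaller volume than the minimum.\<close>

lemma min_form_le:
  assumes p: "min_form p" and q: "min_form q" and x: "x \<in> span B"
  shows "q x x \<le> p x x"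
proof (rule ccontr)
  assume n: "\<not> q x x \<le> p x x"
  have ip: "inner_product_on (span B) p" and iq: "inner_product_on (span B) q"
    and dp: "dominated (span B) p" and dq: "dominated (span B) q"
    using p q by (auto simp: min_form_def)
  have sp: "semi_inner_on (span B) p" and sq: "semi_inner_on (span B) q"
    using ip iq by (auto intro: inner_imp_semi_inner)
  have eq: "vol q = vol p"
    using p q ip iq dp dq by (intro antisym) (auto simp: min_form_def)
  obtain y where y: "y \<in> span B" "p y y < 1" "1 < q y y"
  proof -
    from n obtain m where m: "p x x < m" "m < q x x" using dense by (meson not_le)
    have m0: "m > 0" using m semi_inner_ge0[OF sp x] by linarith
    show ?thesis
    proof (rule that[of "(1 / sqrt m) *\<^sub>R x"])
      show "(1 / sqrt m) *\<^sub>R x \<in> span B" using x by (rule span_scale)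
    qed (use m m0 in \<open>simp_all add: semi_inner_scale_scale[OF sp _ x] semi_inner_scale_scale[OF sq _ x] power_divide\<close>)
  qed
  obtain d where d: "comb d = y" using comb_surj[OF y(1)] .
  define m where "m u v = (p u v + q u v) / 2" for u v
  have im: "inner_product_on (span B) m"
    using ip iq unfolding inner_product_on_def m_def
    by (auto simp: algebra_simps add_divide_distrib add_pos_pos)
  have sm: "semi_inner_on (span B) m" by (rule inner_imp_semi_inner[OF im])
  have dm: "dominated (span B) m"
    using dp dq unfolding dominated_def m_def by (auto simp: field_simps intro: order_trans[OF add_mono])
  let ?P = "\<lambda>c. p (comb c) (comb c)" and ?Q = "\<lambda>c. q (comb c) (comb c)" and ?m = "\<lambda>c. m (comb c) (comb c)"
  let ?g = "\<lambda>c. ennreal (1/2) * ennreal (1 - ?P c) + ennreal (1/2) * ennreal (1 - ?Q c)"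
  have meas[measurable]: "?P \<in> borel_measurable M" "?Q \<in> borel_measurable M" "?m \<in> borel_measurable M"
    by (auto intro: measurable_form_M sp sq sm)
  have half: "ennreal (1/2) * ennreal a = ennreal (max 0 a / 2)" for a
  proof -
    have "ennreal (1/2) * ennreal (max 0 a) = ennreal (1/2 * max 0 a)"
      by (rule ennreal_mult[symmetric]) auto
    moreover have "ennreal (max 0 a) = ennreal a" by (simp add: max_def ennreal_neg)
    ultimately show ?thesis by (metis times_divide_eq_left mult_1)
  qed
  have g: "?g c = ennreal (max 0 (1 - ?P c) / 2 + max 0 (1 - ?Q c) / 2)" for c
    unfolding half by (simp add: ennreal_plus[symmetric] del: ennreal_plus)
  have "bump m < (\<integral>\<^sup>+c. ?g c \<partial>M)"
    unfolding bump_def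
  proof (rule nn_integral_less)
    have "bump m < \<infinity>" using bump_eq[OF sm] bump_const_finite vol_finite[OF im]
      by (simp add: ennreal_mult_less_top)
    then show "(\<integral>\<^sup>+c. ennreal (1 - ?m c) \<partial>M) \<noteq> \<infinity>" by (simp add: bump_def)
    show "AE c in M. ennreal (1 - ?m c) \<le> ?g c"
      unfolding g by (intro AE_I2 ennreal_leI) (simp add: m_def max_def field_simps)
    show "\<not> (AE c in M. ?g c \<le> ennreal (1 - ?m c))"
    proof
      assume "AE c in M. ?g c \<le> ennreal (1 - ?m c)"
      then have "AE c in M. \<not> (?P c < 1 \<and> 1 < ?Q c)"
      proof eventually_elim
        case (elim c)
        show ?case
        proof
          assume pq: "?P c < 1 \<and> 1 < ?Q c"
          have "ennreal ((1 - ?P c) / 2) \<le> ennreal (1 - ?m c)" using elim pq unfolding g by simp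
          then show False using pq by (auto simp: m_def ennreal_le_iff2 field_simps)
        qed
      qed
      then have "emeasure M {c \<in> space M. ?P c < 1 \<and> 1 < ?Q c} = 0"
        by (subst (asm) AE_iff_measurable[OF _ refl]) (auto simp: meas)
      moreover have "emeasure M {c \<in> space M. ?P c < 1 \<and> 1 < ?Q c} > 0"
      proof (rule emeasure_open_pos)
        show "open (?P -` {..<1} \<inter> ?Q -` {1<..})"
          by (intro open_Int open_vimage open_lessThan open_greaterThan continuous_form sp sq)
        have "comb (restrict d B) = y" unfolding d[symmetric] by (intro comb_cong) simp
        then show "restrict d B \<in> ?P -` {..<1} \<inter> ?Q -` {1<..}" using y by simp
        show "?P -` {..<1} \<inter> ?Q -` {1<..} \<inter> extensional B \<subseteq> {c \<in> space M. ?P c < 1 \<and> 1 < ?Q c}"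
          by (auto simp: space_M)
      qed (auto simp: meas)
      ultimately show False by simp
    qed
  qed measurable
  also have "(\<integral>\<^sup>+c. ?g c \<partial>M) = ennreal (1/2) * bump p + ennreal (1/2) * bump q"
    unfolding bump_def by (simp add: nn_integral_add nn_integral_cmult)
  also have "\<dots> = (ennreal (1/2) + ennreal (1/2)) * (bump_const * vol p)"
    by (simp add: bump_eq[OF sp] bump_eq[OF sq] eq distrib_right)
  also have "ennreal (1/2) + ennreal (1/2) = 1"
    by (subst ennreal_plus[symmetric]) auto
  also have "1 * (bump_const * vol p) \<le> bump_const * vol m"
    using p im dm by (auto simp: min_form_def intro: mult_left_mono)
  finally show False by (simp add: bump_eq[OF sm])
qed

lemma min_form_unique:
  assumes "min_form p" "min_form q" "x \<in> span B"
  shows "p x x = q x x"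
  using min_form_le[OF assms] min_form_le[OF assms(2,1,3)] by simp

section \<open>Existence of the minimum volume ellipsoid\<close>

lemma form_le_of_entries:
  assumes p: "semi_inner_on (span B) p" and q: "semi_inner_on (span B) q"
    and le: "\<And>b b'. b \<in> B \<Longrightarrow> b' \<in> B \<Longrightarrow> \<bar>q b b' - p b b'\<bar> \<le> e"
  shows "q (comb c) (comb c) \<le> p (comb c) (comb c) + e * card B * (\<Sum>b\<in>B. (c b)\<^sup>2)"
proof -
  have term_le: "c b * c b' * q b b' - c b * c b' * p b b' \<le> e * (((c b)\<^sup>2 + (c b')\<^sup>2) / 2)"
    if b: "b \<in> B" "b' \<in> B" for b b'
  proof -
    have e: "0 \<le> e" using le[OF b] by linarith
    have "c b * c b' * q b b' - c b * c b' * p b b' \<le> \<bar>c b * c b'\<bar> * \<bar>q b b' - p b b'\<bar>"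
      by (metis abs_ge_self abs_mult right_diff_distrib)
    also have "\<dots> \<le> \<bar>c b * c b'\<bar> * e" using le[OF b] by (intro mult_left_mono) auto
    also have "\<bar>c b * c b'\<bar> \<le> ((c b)\<^sup>2 + (c b')\<^sup>2) / 2"
      using sum_squares_bound[of "\<bar>c b\<bar>" "\<bar>c b'\<bar>"] by (simp add: abs_mult)
    then have "\<bar>c b * c b'\<bar> * e \<le> ((c b)\<^sup>2 + (c b')\<^sup>2) / 2 * e" using e by (rule mult_right_mono)
    finally show ?thesis by (simp add: mult.commute)
  qed
  have "q (comb c) (comb c) - p (comb c) (comb c)
      = (\<Sum>b\<in>B. \<Sum>b'\<in>B. c b * c b' * q b b' - c b * c b' * p b b')"
    by (simp add: form_comb[OF p] form_comb[OF q] sum_subtractf)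
  also have "\<dots> \<le> (\<Sum>b\<in>B. \<Sum>b'\<in>B. e * (((c b)\<^sup>2 + (c b')\<^sup>2) / 2))"
    by (intro sum_mono term_le)
  also have "\<dots> = e / 2 * (\<Sum>b\<in>B. \<Sum>b'\<in>B. (c b)\<^sup>2 + (c b')\<^sup>2)"
    by (simp add: sum_distrib_left field_simps)
  also have "\<dots> = e * card B * (\<Sum>b\<in>B. (c b)\<^sup>2)"
    by (simp add: sum.distrib sum_distrib_left[symmetric])
  finally show ?thesis by simp
qed

text \<open>A limit \<open>p\<close> of a minimising sequence has volume at most the infimum: on coordinates, eventually
\<open>P n \<le> p + \<epsilon> \<Sum>c\<^sup>2\<close>, which bounds the integral for the right-hand side, and Fatou's lemma
lets \<open>\<epsilon>\<close> tend to 0. In particular the volume is finite, so \<open>p\<close> is definite.\<close>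

lemma min_form_exists: "\<exists>p. min_form p"
proof -
  define A where "A = vol ` {q. inner_product_on (span B) q \<and> dominated (span B) q}"
  have "A \<noteq> {}" using dominated_inner_exists by (auto simp: A_def)
  then obtain u where u: "\<And>n. u n \<in> A" "u \<longlonglongrightarrow> Inf A" using Inf_as_limit by blast
  have "\<forall>n. \<exists>q. inner_product_on (span B) q \<and> dominated (span B) q \<and> u n = vol q"
    using u(1) by (auto simp: A_def)
  then obtain P where P: "\<And>n. inner_product_on (span B) (P n)" "\<And>n. dominated (span B) (P n)"
    "\<And>n. u n = vol (P n)" by metis
  have sP: "semi_inner_on (span B) (P n)" for n by (rule inner_imp_semi_inner[OF P(1)])
  obtain G p where G: "G \<noteq> bot" "G \<le> sequentially" and p: "semi_inner_on (span B) p"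
    and lim: "\<And>x y. x \<in> span B \<Longrightarrow> y \<in> span B \<Longrightarrow> ((\<lambda>n. P n x y) \<longlongrightarrow> p x y) G"
    and dom: "\<And>x. x \<in> span B \<Longrightarrow> p x x \<le> (norm x)\<^sup>2"
    using semi_inner_cluster[of sequentially "\<lambda>_. span B" P "span B"] sP P(2)
    by (auto simp: dominated_def)
  let ?p = "\<lambda>c. p (comb c) (comb c)" and ?e = "\<lambda>c. \<Sum>b\<in>B. (c b)\<^sup>2"
  have meas[measurable]: "?p \<in> borel_measurable M" by (rule measurable_form_M[OF p])
  have meas_e[measurable]: "?e \<in> borel_measurable M"
    using measurable_coord by (intro borel_measurable_sum borel_measurable_power) auto
  have up: "(\<integral>\<^sup>+c. ennreal (1 - (?p c + \<epsilon> * ?e c)) \<partial>M) \<le> bump_const * Inf A" if \<epsilon>: "\<epsilon> > 0" for \<epsilon>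
  proof -
    \<comment> \<open>The number of basis vectors is increased by 1 because the basis may be empty.\<close>
    have ev: "eventually (\<lambda>n. \<bar>P n b b' - p b b'\<bar> \<le> \<epsilon> / (card B + 1)) G" if "b \<in> B" "b' \<in> B" for b b'
    proof -
      have "eventually (\<lambda>n. dist (P n b b') (p b b') < \<epsilon> / (card B + 1)) G"
        using lim[OF span_base[OF that(1)] span_base[OF that(2)]] \<epsilon> by (intro tendstoD) auto
      then show ?thesis by (rule eventually_mono) (simp add: dist_real_def)
    qed
    then have "eventually (\<lambda>n. \<forall>b\<in>B. \<forall>b'\<in>B. \<bar>P n b b' - p b b'\<bar> \<le> \<epsilon> / (card B + 1)) G"
      by (simp add: eventually_ball_finite finB)
    then have "eventually (\<lambda>n. (\<integral>\<^sup>+c. ennreal (1 - (?p c + \<epsilon> * ?e c)) \<partial>M) \<le> bump_const * u n) G"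
    proof eventually_elim
      case (elim n)
      have "(\<integral>\<^sup>+c. ennreal (1 - (?p c + \<epsilon> * ?e c)) \<partial>M) \<le> bump (P n)"
        unfolding bump_def
      proof (intro nn_integral_mono ennreal_leI)
        fix c
        have "P n (comb c) (comb c) \<le> ?p c + \<epsilon> / (card B + 1) * card B * ?e c"
          using elim by (intro form_le_of_entries[OF p sP]) auto
        also have "\<epsilon> / (card B + 1) * card B \<le> \<epsilon>" using \<epsilon> by (simp add: field_simps)
        then have "\<epsilon> / (card B + 1) * card B * ?e c \<le> \<epsilon> * ?e c" by (rule mult_right_mono) (simp add: sum_nonneg)
        finally show "1 - (?p c + \<epsilon> * ?e c) \<le> 1 - P n (comb c) (comb c)" by simp
      qed
      then show ?case by (simp add: bump_eq[OF sP] P(3))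
    qed
    moreover have "((\<lambda>n. bump_const * u n) \<longlongrightarrow> bump_const * Inf A) G"
      using bump_const_finite by (intro ennreal_tendsto_cmult tendsto_mono[OF G(2) u(2)]) simp
    ultimately show ?thesis using G(1) by (intro tendsto_lowerbound) auto
  qed
  have "bump p = (\<integral>\<^sup>+c. liminf (\<lambda>n. ennreal (1 - (?p c + 1 / real (Suc n) * ?e c))) \<partial>M)"
    unfolding bump_def
  proof (intro nn_integral_cong)
    fix c
    have "(\<lambda>n. 1 / real (Suc n)) \<longlonglongrightarrow> 0" by (rule lim_1_over_n[THEN LIMSEQ_Suc])
    then have "(\<lambda>n. ennreal (1 - (?p c + 1 / real (Suc n) * ?e c))) \<longlonglongrightarrow> ennreal (1 - (?p c + 0 * ?e c))"
      by (intro tendsto_intros tendsto_ennrealI)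
    then have "liminf (\<lambda>n. ennreal (1 - (?p c + 1 / real (Suc n) * ?e c))) = ennreal (1 - (?p c + 0 * ?e c))"
      by (intro lim_imp_Liminf) auto
    then show "ennreal (1 - ?p c) = liminf (\<lambda>n. ennreal (1 - (?p c + 1 / real (Suc n) * ?e c)))" by simp
  qed
  also have "\<dots> \<le> liminf (\<lambda>n. \<integral>\<^sup>+c. ennreal (1 - (?p c + 1 / real (Suc n) * ?e c)) \<partial>M)"
    by (intro nn_integral_liminf) measurable
  also have "\<dots> \<le> bump_const * Inf A"
    by (intro Liminf_le always_eventually allI up) auto
  finally have le: "vol p \<le> Inf A"
    using bump_const_pos bump_const_finite by (simp add: bump_eq[OF p] ennreal_mult_le_mult_iff)
  have "Inf A < \<infinity>"
    using Inf_lower[OF u(1)[of 0]] P(3)[of 0] vol_finite[OF P(1)[of 0]] by (metis le_less_trans)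
  then have "vol p \<noteq> \<infinity>" using le by auto
  then have "inner_product_on (span B) p"
    using vol_degenerate[OF p] by (intro semi_inner_imp_inner[OF p]) auto
  moreover have "Inf A \<le> vol q" if "inner_product_on (span B) q" "dominated (span B) q" for q
    using that by (intro Inf_lower) (auto simp: A_def)
  ultimately show ?thesis
    using le dom unfolding min_form_def dominated_def by (blast intro: order_trans)
qed

section \<open>Invariance of the minimum volume ellipsoid under isometries\<close>

lemma comb_linear:
  assumes T: "linear T" and TB: "T ` span B \<subseteq> span B"
  obtains \<tau> where "\<And>c. T (comb c) = comb (\<tau> c)" "\<And>b. b \<in> B \<Longrightarrow> (\<lambda>c. \<tau> c b) \<in> borel_measurable M"
proof -
  have "\<exists>a. comb a = T b" if "b \<in> B" for b
    using comb_surj[of "T b"] TB span_base[OF that] by blast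
  then obtain a where a: "\<And>b. b \<in> B \<Longrightarrow> comb (a b) = T b" by metis
  define \<tau> where "\<tau> c b = (\<Sum>b'\<in>B. c b' * a b' b)" for c b
  show ?thesis
  proof (rule that)
    fix c
    have "T (comb c) = (\<Sum>b\<in>B. c b *\<^sub>R T b)"
      unfolding comb_def by (simp add: linear_sum[OF T] linear_scale[OF T])
    also have "\<dots> = (\<Sum>b\<in>B. \<Sum>b'\<in>B. (c b * a b b') *\<^sub>R b')"
      by (simp add: a[symmetric] comb_def scaleR_sum_right)
    also have "\<dots> = comb (\<tau> c)"
      unfolding comb_def \<tau>_def by (subst sum.swap) (simp add: scaleR_sum_left)
    finally show "T (comb c) = comb (\<tau> c)" .
  next
    fix b assume "b \<in> B"
    show "(\<lambda>c. \<tau> c b) \<in> borel_measurable M"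
      unfolding \<tau>_def using measurable_coord by (intro borel_measurable_sum borel_measurable_times) auto
  qed
qed

lemma semi_inner_compose:
  assumes p: "semi_inner_on (span B) p" and T: "linear T" and TB: "T ` span B \<subseteq> span B"
  shows "semi_inner_on (span B) (\<lambda>x y. p (T x) (T y))"
proof -
  have "T x \<in> span B" if "x \<in> span B" for x using TB that by blast
  then show ?thesis
    using p unfolding semi_inner_on_def by (simp add: linear_add[OF T] linear_scale[OF T])
qed

text \<open>This is the Fubini argument for uniqueness of Haar measure. With \<open>P\<close> and \<open>Q\<close> the indicators of the
two ellipsoids and \<open>T\<^sup>-\<^sup>1 x\<close> any preimage of \<open>x\<close> in the span, the translations \<open>y \<mapsto> y + T\<^sup>-\<^sup>1 x\<close>, \<open>x \<mapsto> x - T y\<close> and again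
\<open>y \<mapsto> y + T\<^sup>-\<^sup>1 x\<close> turn the integral of \<open>P(x) Q(T y)\<close> successively into those of
\<open>P(x) Q(x + T y)\<close>, \<open>P(x - T y) Q(x)\<close> and \<open>P(- T y) Q(x)\<close>, and \<open>P\<close> is even.\<close>

lemma vol_compose_linear:
  assumes p: "semi_inner_on (span B) p" and q: "semi_inner_on (span B) q"
    and T: "linear T" and TB: "T ` span B = span B"
  shows "vol p * vol (\<lambda>x y. q (T x) (T y)) = vol q * vol (\<lambda>x y. p (T x) (T y))"
proof -
  interpret pair_sigma_finite M M
    by (intro pair_sigma_finite.intro fps.sigma_finite_measure_axioms)
  obtain \<tau> where \<tau>: "\<And>c. T (comb c) = comb (\<tau> c)"
    and \<tau>m: "\<And>b. b \<in> B \<Longrightarrow> (\<lambda>c. \<tau> c b) \<in> borel_measurable M"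
    using comb_linear[OF T] TB by blast
  define P :: "'a \<Rightarrow> ennreal" where "P = indicator {x. p x x \<le> 1}"
  define Q :: "'a \<Rightarrow> ennreal" where "Q = indicator {x. q x x \<le> 1}"
  have TB': "T x \<in> span B" if "x \<in> span B" for x using TB that by blast
  have volT: "vol (\<lambda>x y. r (T x) (T y)) = (\<integral>\<^sup>+c. indicator {x. r x x \<le> 1} (T (comb c)) \<partial>M)"
    if "semi_inner_on (span B) r" for r
    using vol_eq_nn_integral[OF semi_inner_compose[OF that T]] TB by (simp add: indicator_def)
  note mc = measurable_coord
  have m1: "(\<lambda>c. Q (T (comb c))) \<in> borel_measurable M" "(\<lambda>c. P (T (comb c))) \<in> borel_measurable M"
    using measurable_indicator_comb[OF q \<tau>m] measurable_indicator_comb[OF p \<tau>m] by (simp_all add: P_def Q_def \<tau>)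
  have m2: "(\<lambda>c. P (comb c)) \<in> borel_measurable M" "(\<lambda>c. Q (comb c)) \<in> borel_measurable M"
    using measurable_indicator_form[OF p] measurable_indicator_form[OF q] by (simp_all add: P_def Q_def)
  have fst_m: "(\<lambda>w. f (fst w)) \<in> borel_measurable (M \<Otimes>\<^sub>M M)" and snd_m: "(\<lambda>w. f (snd w)) \<in> borel_measurable (M \<Otimes>\<^sub>M M)"
    if "f \<in> borel_measurable M" for f :: "('a \<Rightarrow> real) \<Rightarrow> 'x::topological_space"
    using that by (auto intro: measurable_compose[OF measurable_fst] measurable_compose[OF measurable_snd])
  have mQ: "(\<lambda>w. Q (comb (fst w) + T (comb (snd w)))) \<in> borel_measurable (M \<Otimes>\<^sub>M M)"
  proof -
    have "(\<lambda>w. Q (comb (\<lambda>b. fst w b + \<tau> (snd w) b))) \<in> borel_measurable (M \<Otimes>\<^sub>M M)"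
      unfolding Q_def
      using \<tau>m by (intro measurable_indicator_comb[OF q] borel_measurable_add fst_m[OF mc] snd_m) auto
    then show ?thesis by (simp add: comb_add \<tau>)
  qed
  have mP: "(\<lambda>w. P (comb (fst w) - T (comb (snd w)))) \<in> borel_measurable (M \<Otimes>\<^sub>M M)"
  proof -
    have "(\<lambda>w. P (comb (\<lambda>b. fst w b - \<tau> (snd w) b))) \<in> borel_measurable (M \<Otimes>\<^sub>M M)"
      unfolding P_def
      using \<tau>m by (intro measurable_indicator_comb[OF p] borel_measurable_diff fst_m[OF mc] snd_m) auto
    then show ?thesis by (simp add: comb_diff \<tau>)
  qed
  have shiftQ: "(\<integral>\<^sup>+d. Q (T (comb d)) \<partial>M) = (\<integral>\<^sup>+d. Q (comb c + T (comb d)) \<partial>M)" for c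
  proof -
    obtain v where v: "v \<in> span B" "T v = comb c" using TB comb_span[of c] by (metis imageE)
    show ?thesis
      using nn_integral_comb_translate[of "\<lambda>x. Q (T x)", OF m1(1) v(1)]
      by (simp add: linear_add[OF T] v(2))
  qed
  have shiftP: "(\<integral>\<^sup>+d. P (comb c - T (comb d)) \<partial>M) = (\<integral>\<^sup>+d. P (T (comb d)) \<partial>M)" if "c \<in> space M" for c
  proof -
    obtain v where v: "v \<in> span B" "T v = comb c" using TB comb_span[of c] by (metis imageE)
    have "(\<integral>\<^sup>+d. P (comb c - T (comb d)) \<partial>M) = (\<integral>\<^sup>+d. P (comb c - T (v + comb d)) \<partial>M)"
    proof (rule nn_integral_comb_translate[of "\<lambda>x. P (comb c - T x)", symmetric, OF _ v(1)])
      show "(\<lambda>d. P (comb c - T (comb d))) \<in> borel_measurable M"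
        using measurable_compose[OF measurable_Pair1'[OF that] mP] by simp
    qed
    also have "\<dots> = (\<integral>\<^sup>+d. P (T (comb d)) \<partial>M)"
      using semi_inner_scale_scale[OF p subspace_span TB'[OF comb_span], of "-1"]
      by (simp add: linear_add[OF T] v(2) P_def indicator_def)
    finally show ?thesis .
  qed
  have "vol p * vol (\<lambda>x y. q (T x) (T y)) = (\<integral>\<^sup>+c. P (comb c) * (\<integral>\<^sup>+d. Q (T (comb d)) \<partial>M) \<partial>M)"
    using m2 by (simp add: vol_eq_nn_integral[OF p] volT[OF q] P_def Q_def nn_integral_multc)
  also have "\<dots> = (\<integral>\<^sup>+c. (\<integral>\<^sup>+d. P (comb c) * Q (comb c + T (comb d)) \<partial>M) \<partial>M)"
  proof (rule nn_integral_cong)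
    fix c assume c: "c \<in> space M"
    have "(\<lambda>d. Q (comb c + T (comb d))) \<in> borel_measurable M"
      using measurable_compose[OF measurable_Pair1'[OF c] mQ] by simp
    then show "P (comb c) * (\<integral>\<^sup>+d. Q (T (comb d)) \<partial>M) = (\<integral>\<^sup>+d. P (comb c) * Q (comb c + T (comb d)) \<partial>M)"
      by (subst nn_integral_cmult) (simp_all add: shiftQ[of c])
  qed
  also have "\<dots> = (\<integral>\<^sup>+d. (\<integral>\<^sup>+c. P (comb c) * Q (comb c + T (comb d)) \<partial>M) \<partial>M)"
    using fst_m[OF m2(1)] mQ by (intro Fubini'[symmetric]) (simp add: case_prod_beta')
  also have "\<dots> = (\<integral>\<^sup>+d. (\<integral>\<^sup>+c. P (comb c - T (comb d)) * Q (comb c) \<partial>M) \<partial>M)"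
  proof (rule nn_integral_cong)
    fix d assume d: "d \<in> space M"
    have "(\<lambda>c. Q (comb c + T (comb d))) \<in> borel_measurable M"
      using measurable_compose[OF measurable_Pair2'[OF d] mQ] by simp
    then have "(\<integral>\<^sup>+c. P (- T (comb d) + comb c) * Q ((- T (comb d) + comb c) + T (comb d)) \<partial>M)
        = (\<integral>\<^sup>+c. P (comb c) * Q (comb c + T (comb d)) \<partial>M)"
      using m2(1) TB'[OF comb_span]
      by (intro nn_integral_comb_translate[of "\<lambda>x. P x * Q (x + T (comb d))"]) (auto intro: span_neg)
    then show "(\<integral>\<^sup>+c. P (comb c) * Q (comb c + T (comb d)) \<partial>M) = (\<integral>\<^sup>+c. P (comb c - T (comb d)) * Q (comb c) \<partial>M)"
      by simp
  qed
  also have "\<dots> = (\<integral>\<^sup>+c. (\<integral>\<^sup>+d. P (comb c - T (comb d)) * Q (comb c) \<partial>M) \<partial>M)"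
    using fst_m[OF m2(2)] mP by (intro Fubini') (simp add: case_prod_beta')
  also have "\<dots> = (\<integral>\<^sup>+c. Q (comb c) * (\<integral>\<^sup>+d. P (T (comb d)) \<partial>M) \<partial>M)"
  proof (rule nn_integral_cong)
    fix c assume c: "c \<in> space M"
    have "(\<lambda>d. P (comb c - T (comb d))) \<in> borel_measurable M"
      using measurable_compose[OF measurable_Pair1'[OF c] mP] by simp
    then show "(\<integral>\<^sup>+d. P (comb c - T (comb d)) * Q (comb c) \<partial>M) = Q (comb c) * (\<integral>\<^sup>+d. P (T (comb d)) \<partial>M)"
      by (subst nn_integral_multc) (simp_all add: shiftP[OF c] mult.commute)
  qed
  also have "\<dots> = vol q * vol (\<lambda>x y. p (T x) (T y))"
    using m2 by (simp add: vol_eq_nn_integral[OF q] volT[OF p] P_def Q_def nn_integral_multc)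
  finally show ?thesis .
qed

end

lemma linear_isometries_inv:
  assumes T: "T \<in> linear_isometries"
  shows "inj T" "inv T \<in> linear_isometries"
proof -
  have lin: "linear T" and su: "surj T" and nm: "\<And>x. norm (T x) = norm x"
    using T by (auto simp: linear_isometries_def)
  show "inj T"
    using lin nm by (metis linear_injective_0 norm_eq_zero)
  then have bij: "bij T" using su by (simp add: bij_def)
  have TS: "T (inv T x) = x" for x using su by (simp add: surj_f_inv_f)
  have "linear (inv T)"
  proof (rule linearI)
    show "inv T (x + y) = inv T x + inv T y" for x y
      by (rule injD[OF \<open>inj T\<close>]) (simp add: TS linear_add[OF lin])
    show "inv T (a *\<^sub>R x) = a *\<^sub>R inv T x" for a x
      by (rule injD[OF \<open>inj T\<close>]) (simp add: TS linear_scale[OF lin])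
  qed
  moreover have "norm (inv T x) = norm x" for x using nm[of "inv T x"] by (simp add: TS)
  ultimately show "inv T \<in> linear_isometries"
    using bij_imp_bij_inv[OF bij] by (simp add: linear_isometries_def bij_def)
qed

context finite_basis
begin

lemma compose_isometry:
  assumes p: "inner_product_on (span B) p" "dominated (span B) p"
    and T: "T \<in> linear_isometries" "T ` span B \<subseteq> span B"
  shows "inner_product_on (span B) (\<lambda>x y. p (T x) (T y))" "dominated (span B) (\<lambda>x y. p (T x) (T y))"
proof -
  have lin: "linear T" and nm: "\<And>x. norm (T x) = norm x"
    using T by (auto simp: linear_isometries_def)
  have TB: "T x \<in> span B" if "x \<in> span B" for x using T(2) that by blast
  show "inner_product_on (span B) (\<lambda>x y. p (T x) (T y))"
  proof (rule semi_inner_imp_inner[OF semi_inner_compose[OF inner_imp_semi_inner[OF p(1)] lin T(2)]])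
    fix x assume "x \<in> span B" "p (T x) (T x) = 0"
    then have "T x = 0" using inner_product_pos[OF p(1) TB] by (metis less_irrefl)
    then show "x = 0" using nm[of x] by simp
  qed
  show "dominated (span B) (\<lambda>x y. p (T x) (T y))"
    using p(2) TB unfolding dominated_def by (metis nm)
qed

text \<open>Taking \<open>q = p \<circ> T\<^sup>-\<^sup>1\<close> in \<open>vol_compose_linear\<close> gives \<open>V(p)\<^sup>2 = V(p \<circ> T\<^sup>-\<^sup>1) V(p \<circ> T)\<close>. Neither factor
on the right is less than the minimum \<open>V(p)\<close>, so both equal it, and uniqueness applies to \<open>p \<circ> T\<close>.\<close>

lemma min_form_invariant:
  assumes p: "min_form p" and T: "T \<in> linear_isometries" and TB: "T ` span B = span B" and x: "x \<in> span B"
  shows "p (T x) (T x) = p x x"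
proof -
  have ip: "inner_product_on (span B) p" and dp: "dominated (span B) p" using p by (auto simp: min_form_def)
  have lin: "linear T" using T by (simp add: linear_isometries_def)
  let ?pT = "\<lambda>x y. p (T x) (T y)" and ?q = "\<lambda>x y. p (inv T x) (inv T y)"
  have SB: "inv T ` span B \<subseteq> span B"
  proof
    fix z assume "z \<in> inv T ` span B"
    then obtain y where "y \<in> span B" "z = inv T (T y)" using TB by (metis imageE)
    then show "z \<in> span B" by (simp add: linear_isometries_inv(1)[OF T])
  qed
  note q = compose_isometry[OF ip dp linear_isometries_inv(2)[OF T] SB]
  note pT = compose_isometry[OF ip dp T eq_refl[OF TB]]
  have "vol p * vol p = vol ?q * vol ?pT"
    using vol_compose_linear[OF inner_imp_semi_inner[OF ip] inner_imp_semi_inner[OF q(1)] lin TB]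
    by (simp add: linear_isometries_inv(1)[OF T])
  also have "\<dots> \<ge> vol p * vol ?pT"
    using p q by (intro mult_right_mono) (auto simp: min_form_def)
  finally have "vol ?pT \<le> vol p"
    using vol_pos[OF inner_imp_semi_inner[OF ip]] vol_finite[OF ip]
    by (simp add: ennreal_mult_le_mult_iff)
  then have "min_form ?pT"
    using p pT unfolding min_form_def by (blast intro: order_trans)
  from min_form_unique[OF this p x] show ?thesis .
qed

end

section \<open>The form of the minimum volume ellipsoid of a subspace\<close>

lemma finite_dim_basis:
  assumes "finite_dim_subspace E"
  shows "finite (SOME B. linear_basis E B)" "linear_basis E (SOME B. linear_basis E B)"
proof -
  obtain A where A: "finite A" "E = span A" using assms by (auto simp: finite_dim_subspace_def)
  have "\<exists>B. linear_basis E B"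
    unfolding linear_basis_def A(2) using basis_exists[of "span A"] span_subspace subspace_span by metis
  then show *: "linear_basis E (SOME B. linear_basis E B)" by (rule someI_ex)
  then have "independent (SOME B. linear_basis E B)" "(SOME B. linear_basis E B) \<subseteq> span A"
    using A(2) span_superset by (auto simp: linear_basis_def)
  then show "finite (SOME B. linear_basis E B)"
    using independent_span_bound[OF A(1)] by blast
qed

lemma min_volume_ellipsoid_form:
  fixes E :: "'a::real_normed_vector set"
  assumes E: "finite_dim_subspace E"
  obtains p where "inner_product_on E p" "dominated E p"
    "min_volume_ellipsoid E = {x \<in> E. p x x \<le> 1}"
    "\<And>T x. T \<in> linear_isometries \<Longrightarrow> T ` E = E \<Longrightarrow> x \<in> E \<Longrightarrow> p (T x) (T x) = p x x"
proof -
  define B where "B = (SOME B. linear_basis E B)"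
  have B: "finite B" "independent B" "span B = E"
    using finite_dim_basis[OF E] by (auto simp: B_def linear_basis_def)
  interpret finite_basis B by standard (use B in auto)
  have sv: "subspace_volume E {x \<in> E. q x x \<le> 1} = vol q" for q
    using coord_volume_eq_vol[of q] by (simp add: subspace_volume_def B_def[symmetric] B(3))
  have sub: "subspace E" using B(3) subspace_span by blast
  have dom: "cball 0 1 \<inter> E \<subseteq> {x \<in> E. q x x \<le> 1} \<longleftrightarrow> dominated E q" if "inner_product_on E q" for q
    using dominated_iff_ball_subset[OF inner_imp_semi_inner[OF that] sub] by simp
  obtain p where p: "min_form p" using min_form_exists by blast
  then have ip: "inner_product_on E p" and dp: "dominated E p" by (auto simp: min_form_def B(3))
  have "min_volume_ellipsoid E = {x \<in> E. p x x \<le> 1}"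
    unfolding min_volume_ellipsoid_def
  proof (rule the_equality)
    show "ellipsoid E {x \<in> E. p x x \<le> 1} \<and> cball 0 1 \<inter> E \<subseteq> {x \<in> E. p x x \<le> 1} \<and>
        (\<forall>S'. ellipsoid E S' \<and> cball 0 1 \<inter> E \<subseteq> S' \<longrightarrow>
          subspace_volume E {x \<in> E. p x x \<le> 1} \<le> subspace_volume E S')"
    proof (intro conjI allI impI)
      show "ellipsoid E {x \<in> E. p x x \<le> 1}" using ip by (auto simp: ellipsoid_def)
      show "cball 0 1 \<inter> E \<subseteq> {x \<in> E. p x x \<le> 1}" using dom[OF ip] dp by blast
      fix S' assume S': "ellipsoid E S' \<and> cball 0 1 \<inter> E \<subseteq> S'"
      then obtain q where q: "inner_product_on E q" "S' = {x \<in> E. q x x \<le> 1}" by (auto simp: ellipsoid_def)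
      then have "dominated E q" using dom[OF q(1)] S' by blast
      then show "subspace_volume E {x \<in> E. p x x \<le> 1} \<le> subspace_volume E S'"
        using p q by (simp add: sv min_form_def B(3))
    qed
  next
    fix S assume S: "ellipsoid E S \<and> cball 0 1 \<inter> E \<subseteq> S \<and>
        (\<forall>S'. ellipsoid E S' \<and> cball 0 1 \<inter> E \<subseteq> S' \<longrightarrow> subspace_volume E S \<le> subspace_volume E S')"
    then obtain q where q: "inner_product_on E q" "S = {x \<in> E. q x x \<le> 1}" by (auto simp: ellipsoid_def)
    have dq: "dominated E q" using dom[OF q(1)] S q(2) by blast
    have "vol q \<le> vol r" if r: "inner_product_on E r" "dominated E r" for r
    proof -
      have "ellipsoid E {x \<in> E. r x x \<le> 1}" using r by (auto simp: ellipsoid_def)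
      moreover have "cball 0 1 \<inter> E \<subseteq> {x \<in> E. r x x \<le> 1}" using dom[OF r(1)] r(2) by blast
      ultimately have "subspace_volume E S \<le> subspace_volume E {x \<in> E. r x x \<le> 1}" using S by blast
      then show ?thesis by (simp add: q(2) sv)
    qed
    then have "min_form q" using q(1) dq by (simp add: min_form_def B(3))
    then have "p x x = q x x" if "x \<in> E" for x
      using min_form_unique[OF p] that B(3) by blast
    then show "S = {x \<in> E. p x x \<le> 1}" by (auto simp: q(2))
  qed
  then show ?thesis
    using that[OF ip dp] min_form_invariant[OF p] B(3) by blast
qed

text \<open>This makes the supremum in \<open>eta\<close> an upper bound: a real supremum of an unbounded set carries no information.\<close>

lemma blinfun_bounded_on_ellipsoid:
  fixes f :: "'a::real_normed_vector \<Rightarrow>\<^sub>L real"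
  assumes E: "finite_dim_subspace E" and p: "inner_product_on E p"
  shows "bdd_above ((\<lambda>y. \<bar>blinfun_apply f y\<bar>) ` {x \<in> E. p x x \<le> 1})"
proof -
  define B where "B = (SOME B. linear_basis E B)"
  have B: "finite B" "independent B" "span B = E"
    using finite_dim_basis[OF E] by (auto simp: B_def linear_basis_def)
  interpret finite_basis B by standard (use B in auto)
  obtain r where r: "\<And>c b. p (comb c) (comb c) \<le> 1 \<Longrightarrow> b \<in> B \<Longrightarrow> \<bar>c b\<bar> \<le> r"
    using sublevel_coords_bounded[of p] p B(3) by metis
  show ?thesis
  proof (rule bdd_aboveI2)
    fix y assume y: "y \<in> {x \<in> E. p x x \<le> 1}"
    then obtain c where c: "comb c = y" using comb_surj[of y] B(3) by auto
    have "blinfun_apply f y = (\<Sum>b\<in>B. c b * blinfun_apply f b)"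
      unfolding c[symmetric] comb_def by (simp add: blinfun.sum_right blinfun.scaleR_right)
    also have "\<bar>\<dots>\<bar> \<le> (\<Sum>b\<in>B. \<bar>c b * blinfun_apply f b\<bar>)" by (rule sum_abs)
    also have "\<dots> \<le> (\<Sum>b\<in>B. r * \<bar>blinfun_apply f b\<bar>)"
      using r c y by (intro sum_mono) (simp add: abs_mult mult_right_mono)
    finally show "\<bar>blinfun_apply f y\<bar> \<le> (\<Sum>b\<in>B. r * \<bar>blinfun_apply f b\<bar>)" .
  qed
qed

lemma functional_le_eta:
  fixes f :: "'a::real_normed_vector \<Rightarrow>\<^sub>L real"
  assumes E: "finite_dim_subspace E" and p: "inner_product_on E p"
    and m: "min_volume_ellipsoid E = {x \<in> E. p x x \<le> 1}" and x: "x \<in> E"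
    and C: "eta f E \<le> C"
  shows "(blinfun_apply f x)\<^sup>2 \<le> C\<^sup>2 * p x x"
proof (cases "x = 0")
  case True
  then show ?thesis using semi_inner_ge0[OF inner_imp_semi_inner[OF p] x] by simp
next
  case False
  have sub: "subspace E" using E by (auto simp: finite_dim_subspace_def)
  have pos: "p x x > 0" by (rule inner_product_pos[OF p x False])
  define y where "y = (1 / sqrt (p x x)) *\<^sub>R x"
  have "p y y = 1"
    using pos by (simp add: y_def semi_inner_scale_scale[OF inner_imp_semi_inner[OF p] sub x] power_divide)
  then have "\<bar>blinfun_apply f y\<bar> \<le> eta f E"
    unfolding eta_def m using x sub
    by (intro cSUP_upper blinfun_bounded_on_ellipsoid[OF E p]) (simp add: y_def subspace_scale)
  then have "\<bar>blinfun_apply f y\<bar> \<le> C" using C by linarith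
  then have "(blinfun_apply f y)\<^sup>2 \<le> C\<^sup>2" by (metis abs_ge_zero power2_abs power_mono)
  moreover have "blinfun_apply f y = blinfun_apply f x / sqrt (p x x)"
    by (simp add: y_def blinfun.scaleR_right)
  ultimately show ?thesis using pos by (simp add: power_divide field_simps)
qed

section \<open>Invariant forms on convex-transitive spaces\<close>

lemma convex_sublevel:
  assumes p: "semi_inner_on UNIV p"
  shows "convex {x. p x x \<le> r}"
proof (rule convexI)
  fix x y and u v :: real
  assume x: "x \<in> {x. p x x \<le> r}" and y: "y \<in> {x. p x x \<le> r}" and uv: "0 \<le> u" "0 \<le> v" "u + v = 1"
  have "0 \<le> p (x + (-1) *\<^sub>R y) (x + (-1) *\<^sub>R y)" by (rule semi_inner_ge0[OF p]) simp
  then have xy: "2 * p x y \<le> p x x + p y y" by (subst (asm) semi_inner_expand[OF p]) auto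
  have "p (u *\<^sub>R x + v *\<^sub>R y) (u *\<^sub>R x + v *\<^sub>R y) = u\<^sup>2 * p x x + u * v * (2 * p x y) + v\<^sup>2 * p y y"
    by (subst semi_inner_expand[OF p]) (simp_all add: semi_inner_scale_right[OF p] semi_inner_scale[OF p] power2_eq_square)
  also have "\<dots> \<le> u\<^sup>2 * p x x + u * v * (p x x + p y y) + v\<^sup>2 * p y y"
    using xy uv by (intro add_mono mult_left_mono) auto
  also have "\<dots> = (u + v) * (u * p x x + v * p y y)" by (simp add: power2_eq_square algebra_simps)
  also have "\<dots> \<le> u * r + v * r" using x y uv by (auto intro: add_mono mult_left_mono)
  also have "\<dots> = r" using uv by (simp add: distrib_right[symmetric])
  finally show "u *\<^sub>R x + v *\<^sub>R y \<in> {x. p x x \<le> r}" by simp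
qed

lemma closed_sublevel:
  fixes p :: "'a::real_normed_vector \<Rightarrow> 'a \<Rightarrow> real"
  assumes p: "semi_inner_on UNIV p" and d: "dominated UNIV p"
  shows "closed {x. p x x \<le> r}"
proof -
  have bound: "norm (p x y) \<le> norm x * norm y * 1" for x y
    using semi_inner_bound[OF p subspace_UNIV UNIV_I UNIV_I] d by (simp add: dominated_def)
  have "bounded_bilinear p"
  proof
    show "\<exists>K. \<forall>x y. norm (p x y) \<le> norm x * norm y * K" using bound by blast
  qed (simp_all only: semi_inner_add[OF p] semi_inner_add_right[OF p subspace_UNIV]
      semi_inner_scale[OF p] semi_inner_scale_right[OF p subspace_UNIV] UNIV_I real_scaleR_def)
  then have "continuous_on UNIV (\<lambda>x. p x x)"
    by (rule bounded_bilinear.continuous_on[OF _ continuous_on_id continuous_on_id])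
  then show ?thesis by (rule closed_Collect_le[OF _ continuous_on_const])
qed

text \<open>For unit vectors \<open>x\<close> and \<open>y\<close>, the closed convex set \<open>{y. p y y \<le> p x x}\<close> contains the orbit of \<open>x\<close>, so by
convex-transitivity it contains \<open>y\<close>. By symmetry \<open>p\<close> is constant on the unit sphere.\<close>

lemma norm_hilbert_of_invariant_form:
  fixes p :: "'a::real_normed_vector \<Rightarrow> 'a \<Rightarrow> real"
  assumes p: "semi_inner_on UNIV p" and d: "dominated UNIV p"
    and inv: "\<And>T x. T \<in> G \<Longrightarrow> p (T x) (T x) = p x x"
    and trans: "convex_transitive G" and nz: "p z z \<noteq> 0"
  obtains q where "inner_product_on UNIV q" "\<And>x::'a. norm x = sqrt (q x x)"
proof -
  have le: "p y y \<le> p x x" if x: "norm x = 1" and y: "norm y = 1" for x y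
  proof -
    have "{T x | T. T \<in> G} \<subseteq> {y. p y y \<le> p x x}" using inv by auto
    then have "closure (convex hull {T x | T. T \<in> G}) \<subseteq> {y. p y y \<le> p x x}"
      by (intro closure_minimal hull_minimal convex_sublevel[OF p] closed_sublevel[OF p d])
    moreover have "y \<in> closure (convex hull {T x | T. T \<in> G})"
      using trans x y by (auto simp: convex_transitive_def)
    ultimately show ?thesis by blast
  qed
  have z0: "z \<noteq> 0" using nz semi_inner_0[OF p] by auto
  define k where "k = p z z / (norm z)\<^sup>2"
  have eq: "p x x = k * (norm x)\<^sup>2" for x
  proof (cases "x = 0")
    case True
    then show ?thesis using semi_inner_0[OF p] by simp
  next
    case False
    have "p ((1 / norm x) *\<^sub>R x) ((1 / norm x) *\<^sub>R x) = p ((1 / norm z) *\<^sub>R z) ((1 / norm z) *\<^sub>R z)"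
      using False z0 by (intro antisym le) auto
    then show ?thesis using False z0
      by (simp add: semi_inner_scale_scale[OF p] power_divide k_def field_simps)
  qed
  have k: "k > 0" using nz semi_inner_ge0[OF p, of z] z0 by (simp add: k_def)
  define q where "q x y = p x y / k" for x y
  have qn: "q x x = (norm x)\<^sup>2" for x using k by (simp add: q_def eq)
  have "inner_product_on UNIV q"
  proof (rule semi_inner_imp_inner)
    show "semi_inner_on UNIV q"
      using p k unfolding semi_inner_on_def q_def by (auto simp: add_divide_distrib[symmetric])
  qed (simp add: qn)
  then show ?thesis by (rule that) (simp add: qn)
qed

section \<open>Spaces with directionally Euclidean structure\<close>

theorem theorem3p1:
  fixes f :: "'a::banach \<Rightarrow>\<^sub>L real"
  assumes "norm f = 1"
    and "DES f"
    and "convex_transitive (finite_rank_isometries :: ('a \<Rightarrow> 'a) set)"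
  shows "isometrically_hilbert TYPE('a)"
proof -
  obtain H where H: "finite_dim_subspace H"
    and "(SUP E\<in>{E. finite_dim_subspace E \<and> H \<subseteq> E}. ereal (eta f E)) < \<infinity>"
    using assms(2) unfolding DES_def INF_less_iff by blast
  then obtain n :: nat where "(SUP E\<in>{E. finite_dim_subspace E \<and> H \<subseteq> E}. ereal (eta f E)) < ereal (real n)"
    using less_PInf_Ex_of_nat by (metis less_irrefl)
  then have eta_le: "eta f E \<le> real n" if "finite_dim_subspace E" "H \<subseteq> E" for E
    using that SUP_upper[of E "{E. finite_dim_subspace E \<and> H \<subseteq> E}" "\<lambda>E. ereal (eta f E)"]
    by (metis (mono_tags, lifting) ereal_less_eq(3) less_imp_le mem_Collect_eq order_trans)
  \<comment> \<open>Subspaces are indexed by finite spanning sets; infinite index sets get the zero subspace.\<close>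
  define S :: "'a set \<Rightarrow> 'a set" where "S i = span (if finite i then i else {})" for i
  have fdS: "finite_dim_subspace (S i)" for i
    unfolding S_def finite_dim_subspace_def by (metis finite.emptyI)
  define ok where "ok E p \<longleftrightarrow> inner_product_on E p \<and> dominated E p \<and>
      min_volume_ellipsoid E = {x \<in> E. p x x \<le> 1} \<and>
      (\<forall>T x. T \<in> linear_isometries \<longrightarrow> T ` E = E \<longrightarrow> x \<in> E \<longrightarrow> p (T x) (T x) = p x x)"
    for E :: "'a set" and p
  have "\<exists>p. ok (S i) p" for i
    unfolding ok_def by (rule min_volume_ellipsoid_form[OF fdS[of i]]) blast
  then obtain P where "\<And>i. ok (S i) (P i)" by metis
  then have P: "\<And>i. inner_product_on (S i) (P i)" "\<And>i. dominated (S i) (P i)"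
    "\<And>i. min_volume_ellipsoid (S i) = {x \<in> S i. P i x x \<le> 1}"
    "\<And>i T x. T \<in> linear_isometries \<Longrightarrow> T ` S i = S i \<Longrightarrow> x \<in> S i \<Longrightarrow> P i (T x) (T x) = P i x x"
    by (simp_all add: ok_def)
  let ?F = "finite_subsets_at_top (UNIV :: 'a set)"
  have evA: "eventually (\<lambda>i. span A \<subseteq> S i) ?F" if "finite A" for A
    unfolding eventually_finite_subsets_at_top using that
    by (intro exI[of _ A]) (auto simp: S_def intro: span_mono[THEN subsetD])
  have evx: "eventually (\<lambda>i. x \<in> S i) ?F" for x
    by (rule eventually_mono[OF evA[of "{x}"]]) (auto intro: span_base)
  obtain G p where G: "G \<noteq> bot" "G \<le> ?F" and p: "semi_inner_on UNIV p"
    and lim: "\<And>x y. ((\<lambda>i. P i x y) \<longlongrightarrow> p x y) G" and dom: "\<And>x. p x x \<le> (norm x)\<^sup>2"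
    using semi_inner_cluster[of ?F S P UNIV] inner_imp_semi_inner[OF P(1)] P(2) evx
    by (auto simp: S_def dominated_def)
  have evG: "eventually Q G" if "eventually Q ?F" for Q using that G(2) by (simp add: filter_leD)
  have inv: "p (T x) (T x) = p x x" if T: "T \<in> finite_rank_isometries" for T x
  proof -
    have Tl: "T \<in> linear_isometries" and lin: "linear T" and su: "surj T"
      using T by (auto simp: finite_rank_isometries_def linear_isometries_def)
    obtain A where A: "finite A" "range (\<lambda>x. x - T x) = span A"
      using T by (auto simp: finite_rank_isometries_def finite_dim_subspace_def)
    have "eventually (\<lambda>i. P i (T x) (T x) = P i x x) G"
      using evG[OF evA[OF A(1)]] evG[OF evx[of x]]
    proof eventually_elim
      case (elim i)
      have sub: "subspace (S i)" by (simp add: S_def)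
      \<comment> \<open>Since the range of \<open>I - T\<close> lies in \<open>S i\<close>, membership in \<open>S i\<close> is the same for \<open>y\<close> and \<open>T y\<close>.\<close>
      have d: "y - T y \<in> S i" for y using elim(1) A(2) by blast
      have "T ` S i = S i"
      proof (intro equalityI subsetI)
        fix y assume "y \<in> T ` S i"
        then obtain u where "u \<in> S i" "y = T u" by blast
        then show "y \<in> S i" using subspace_diff[OF sub _ d[of u], of u] by simp
      next
        fix y assume y: "y \<in> S i"
        obtain u where u: "T u = y" using su by (metis surjD)
        have "u \<in> S i" using subspace_add[OF sub d[of u] y] u by simp
        then show "y \<in> T ` S i" using u by blast
      qed
      then show ?case using P(4)[OF Tl] elim(2) by blast
    qed
    then show ?thesis
      by (metis G(1) Lim_transform_eventually lim tendsto_unique)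
  qed
  obtain A where A: "finite A" "H = span A" using H by (auto simp: finite_dim_subspace_def)
  have lower: "(blinfun_apply f x)\<^sup>2 \<le> (real n)\<^sup>2 * p x x" for x
  proof (rule tendsto_lowerbound[OF _ _ G(1)])
    show "((\<lambda>i. (real n)\<^sup>2 * P i x x) \<longlongrightarrow> (real n)\<^sup>2 * p x x) G" by (intro tendsto_intros lim)
    show "eventually (\<lambda>i. (blinfun_apply f x)\<^sup>2 \<le> (real n)\<^sup>2 * P i x x) G"
      using evG[OF evA[OF A(1)]] evG[OF evx[of x]]
    proof eventually_elim
      case (elim i)
      have "eta f (S i) \<le> real n" using eta_le[OF fdS] elim(1) A(2) by blast
      then show ?case by (rule functional_le_eta[OF fdS P(1,3) elim(2)])
    qed
  qed
  have "f \<noteq> 0" using assms(1) by auto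
  then obtain z where z: "blinfun_apply f z \<noteq> 0" by (metis blinfun_eqI zero_blinfun.rep_eq)
  have "p z z \<noteq> 0" using lower[of z] z by auto
  moreover have "dominated UNIV p" using dom by (simp add: dominated_def)
  ultimately obtain q where "inner_product_on UNIV q" "\<And>x::'a. norm x = sqrt (q x x)"
    using norm_hilbert_of_invariant_form[of p finite_rank_isometries z] p inv assms(3) by blast
  then show ?thesis
    unfolding isometrically_hilbert_def using complete_UNIV by blast
qed

end
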